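(* Let $(M,g)$ be a manifold of cohomogeneity one under the action of a compact, simply-connected Lie group $G$ with connected isotropy subgroup $K$, such that the irreducible summands $\mathfrak p_0,\dots,\mathfrak p_m$ of the isotropy representation are pairwise inequivalent and $\dim\mathfrak p_0=1$, with metric written as in the context in terms of functions $h$ and $A_1,\dots,A_m$. The function $h$ can be written as $$h=\frac{1}{V^{1/2}}\int\Big[\int(S^*-S)V^{1/2}\,dx\Big]dx,\qquad V^{1/2}=\prod_{j=1}^mA_j^{d_j/2},$$ if and only if $$\sum_{j=1}^md_j\Big[2\frac{A_j''}{A_j}-\Big(\frac{A_j'}{A_j}\Big)^2+\frac{b_j^2}{A_j^2}\Big]=0.$$
   Context: Cohomogeneity one: $G$ acts by isometries with principal orbits $G/K$ of codimension one. Write $\mathfrak g=\mathfrak k\oplus\mathfrak p_0\oplus\dots\oplus\mathfrak p_m$ with $\mathfrak p_i$ irreducible $\mathrm{Ad}(K)$-invariant subspaces, $d_i=\dim\mathfrak p_i$, and fix an $\mathrm{Ad}(K)$-invariant background inner product $Q$ on $\mathfrak p_0\oplus\dots\oplus\mathfrak p_m$. On the union of principal orbits, with a suitable coordinate $x$ on the quotient (defined by $\frac1h dx^2=dt^2$, $t$ the arclength of a normal geodesic), $$g=\frac1h\,dx^2+h\,Q|_{\mathfrak p_0}+\sum_{i=1}^mA_i\,Q|_{\mathfrak p_i},$$ where $h$ and the $A_i$ are positive functions of $x$; $'=\frac{d}{dx}$. $S=S(x)$ is the scalar curvature of $(M,g)$. The scalar curvature $\hat S$ of the principal orbit at $x$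 (with the induced homogeneous metric) decomposes as $\hat S=S_h+S^*$, where $S_h$ consists of all terms involving $h$ and $S^*$ depends only on the $A_i$; one has $S_h=-h\sum_{j=1}^m\frac{d_j}{4}\frac{b_j^2}{A_j^2}$ for constants $b_j$ determined by $G$, $K$ and $Q$, and these are the $b_j$ in the statement. The iterated indefinite integral is understood with some choice of the two constants of integration. *)

theory Defs
  imports "HOL-Analysis.Analysis" "HOL-Algebra.Group_Action"
begin

section \<open>Smooth functions and smooth manifolds\<close>

primrec Ck_on ::
  "nat \<Rightarrow> 'a::euclidean_space set \<Rightarrow> ('a \<Rightarrow> 'b::real_normed_vector) \<Rightarrow> bool" where
  "Ck_on 0 S f \<longleftrightarrow> continuous_on S f"
| "Ck_on (Suc k) S f \<longleftrightarrow>
     (\<forall>x\<in>S. f differentiable (at x)) \<and> (\<forall>v. Ck_on k S (\<lambda>x. frechet_derivative f (at x) v))"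

text \<open>Only used for open \<open>S\<close>.\<close>

definition smooth_on ::
  "'a::euclidean_space set \<Rightarrow> ('a \<Rightarrow> 'b::real_normed_vector) \<Rightarrow> bool" where
  "smooth_on S f \<longleftrightarrow> (\<forall>k. Ck_on k S f)"

text \<open>A chart is a pair of its domain and its coordinate map; the values of the coordinate map
  outside the domain are irrelevant. The underlying set of a manifold is the whole type \<open>'m\<close>, the
  model space is \<open>'e\<close>.\<close>

type_synonym ('m, 'e) chart = "'m set \<times> ('m \<Rightarrow> 'e)"

definition is_chart :: "('m::topological_space, 'e::euclidean_space) chart \<Rightarrow> bool" where
  "is_chart c \<longleftrightarrow> open (fst c) \<and> open (snd c ` fst c) \<and>
     homeomorphism (fst c) (snd c ` fst c) (snd c) (inv_into (fst c) (snd c))"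

definition coord_map ::
  "('m, 'e) chart \<Rightarrow> ('n, 'f) chart \<Rightarrow> ('m \<Rightarrow> 'n) \<Rightarrow> 'e \<Rightarrow> 'f" where
  "coord_map c d f = snd d \<circ> f \<circ> inv_into (fst c) (snd c)"

definition smooth_in_charts ::
  "('m, 'e::euclidean_space) chart \<Rightarrow> ('n, 'f::euclidean_space) chart \<Rightarrow> ('m \<Rightarrow> 'n) \<Rightarrow> bool" where
  "smooth_in_charts c d f \<longleftrightarrow> smooth_on (snd c ` (fst c \<inter> f -` fst d)) (coord_map c d f)"

definition compatible ::
  "('m, 'e::euclidean_space) chart \<Rightarrow> ('m, 'e) chart \<Rightarrow> bool" where
  "compatible c d \<longleftrightarrow> smooth_in_charts c d id \<and> smooth_in_charts d c id"

text \<open>A smooth structure is a maximal smooth atlas. Second countability and the Hausdorff property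
  are sort constraints on the type of points.\<close>

definition smooth_structure ::
  "('m::{t2_space,second_countable_topology}, 'e::euclidean_space) chart set \<Rightarrow> bool" where
  "smooth_structure \<A> \<longleftrightarrow>
     (\<forall>c\<in>\<A>. is_chart c) \<and> (\<Union>c\<in>\<A>. fst c) = UNIV \<and>
     (\<forall>c\<in>\<A>. \<forall>d\<in>\<A>. compatible c d) \<and>
     (\<forall>c. is_chart c \<and> (\<forall>d\<in>\<A>. compatible c d) \<longrightarrow> c \<in> \<A>)"

definition smooth_map ::
  "('m::topological_space, 'e::euclidean_space) chart set \<Rightarrow>
   ('n::topological_space, 'f::euclidean_space) chart set \<Rightarrow> ('m \<Rightarrow> 'n) \<Rightarrow> bool" where
  "smooth_map \<A> \<B> f \<longleftrightarrow>
     continuous_on UNIV f \<and> (\<forall>c\<in>\<A>. \<forall>d\<in>\<B>. smooth_in_charts c d f)"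

text \<open>An atlas of the product manifold (not maximal, which \<^const>\<open>smooth_map\<close> does not need).\<close>

definition prod_atlas ::
  "('m, 'e) chart set \<Rightarrow> ('n, 'f) chart set \<Rightarrow> ('m \<times> 'n, 'e \<times> 'f) chart set" where
  "prod_atlas \<A> \<B> = {(fst c \<times> fst d, map_prod (snd c) (snd d)) | c d. c \<in> \<A> \<and> d \<in> \<B>}"

text \<open>The differential of \<open>f\<close> at \<open>q\<close>, with both tangent spaces identified with the model spaces
  through the charts \<open>c\<close> and \<open>d\<close>.\<close>

definition tangent_map ::
  "('m, 'e::euclidean_space) chart \<Rightarrow> ('n, 'f::euclidean_space) chart \<Rightarrow>
   ('m \<Rightarrow> 'n) \<Rightarrow> 'm \<Rightarrow> 'e \<Rightarrow> 'f" where
  "tangent_map c d f q = frechet_derivative (coord_map c d f) (at (snd c q))"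


section \<open>Riemannian metrics and scalar curvature\<close>

text \<open>A tensor field of type \<open>(0,2)\<close> is given by its expressions in all charts:
  \<open>g c y u v\<close> is its value at the point with coordinates \<open>y\<close> in the chart \<open>c\<close>, on the tangent
  vectors with coordinates \<open>u\<close> and \<open>v\<close>.\<close>

type_synonym ('m, 'e) tensor2 = "('m, 'e) chart \<Rightarrow> 'e \<Rightarrow> 'e \<Rightarrow> 'e \<Rightarrow> real"

definition isometric ::
  "('m, 'e::euclidean_space) chart set \<Rightarrow> ('m, 'e) tensor2 \<Rightarrow> ('m \<Rightarrow> 'm) \<Rightarrow> bool" where
  "isometric \<A> g f \<longleftrightarrow>
     (\<forall>c\<in>\<A>. \<forall>d\<in>\<A>. \<forall>q\<in>fst c. f q \<in> fst d \<longrightarrow>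
        (\<forall>u v. g d (snd d (f q)) (tangent_map c d f q u) (tangent_map c d f q v)
               = g c (snd c q) u v))"

text \<open>The last condition is the transformation law under changes of charts.\<close>

definition riemannian_metric ::
  "('m, 'e::euclidean_space) chart set \<Rightarrow> ('m, 'e) tensor2 \<Rightarrow> bool" where
  "riemannian_metric \<A> g \<longleftrightarrow>
     (\<forall>c\<in>\<A>.
        (\<forall>y\<in>snd c ` fst c. bilinear (g c y) \<and> (\<forall>u v. g c y u v = g c y v u) \<and>
            (\<forall>u. u \<noteq> 0 \<longrightarrow> g c y u u > 0)) \<and>
        (\<forall>u v. smooth_on (snd c ` fst c) (\<lambda>y. g c y u v))) \<and>
     isometric \<A> g id"

text \<open>In the following, \<open>g y u v\<close> is a metric on an open subset of \<open>'e\<close>. The vector \<open>sharp B \<alpha>\<close> is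
  dual to the linear form \<open>\<alpha>\<close> with respect to the inner product \<open>B\<close>, and
  \<open>christoffel g y u v\<close> is the vector with components \<open>\<Gamma>\<^sup>k\<^sub>i\<^sub>j u\<^sup>i v\<^sup>j\<close>. The curvature convention is
  \<open>R(u,v)w = D\<^sub>u D\<^sub>v w - D\<^sub>v D\<^sub>u w - D\<^sub>[\<^sub>u\<^sub>,\<^sub>v\<^sub>] w\<close>, \<open>Ric(v,w) = tr (u \<mapsto> R(u,v)w)\<close>, so that round spheres have
  positive scalar curvature.\<close>

definition sharp :: "('e \<Rightarrow> 'e \<Rightarrow> real) \<Rightarrow> ('e \<Rightarrow> real) \<Rightarrow> 'e::euclidean_space" where
  "sharp B \<alpha> = (THE z. \<forall>w. B z w = \<alpha> w)"

definition christoffel ::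
  "('e \<Rightarrow> 'e \<Rightarrow> 'e \<Rightarrow> real) \<Rightarrow> 'e \<Rightarrow> 'e \<Rightarrow> 'e \<Rightarrow> 'e::euclidean_space" where
  "christoffel g y u v = sharp (g y) (\<lambda>w.
     (frechet_derivative (\<lambda>z. g z v w) (at y) u
      + frechet_derivative (\<lambda>z. g z u w) (at y) v
      - frechet_derivative (\<lambda>z. g z u v) (at y) w) / 2)"

definition curvature ::
  "('e \<Rightarrow> 'e \<Rightarrow> 'e \<Rightarrow> real) \<Rightarrow> 'e \<Rightarrow> 'e \<Rightarrow> 'e \<Rightarrow> 'e \<Rightarrow> 'e::euclidean_space" where
  "curvature g y u v w =
     frechet_derivative (\<lambda>z. christoffel g z v w) (at y) u
     - frechet_derivative (\<lambda>z. christoffel g z u w) (at y) v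
     + christoffel g y u (christoffel g y v w)
     - christoffel g y v (christoffel g y u w)"

definition ricci ::
  "('e::euclidean_space \<Rightarrow> 'e \<Rightarrow> 'e \<Rightarrow> real) \<Rightarrow> 'e \<Rightarrow> 'e \<Rightarrow> 'e \<Rightarrow> real" where
  "ricci g y v w = (\<Sum>e\<in>Basis. curvature g y e v w \<bullet> e)"

definition scalar_curvature_at ::
  "('e::euclidean_space \<Rightarrow> 'e \<Rightarrow> 'e \<Rightarrow> real) \<Rightarrow> 'e \<Rightarrow> real" where
  "scalar_curvature_at g y = (\<Sum>e\<in>Basis. sharp (g y) (ricci g y e) \<bullet> e)"

text \<open>The function \<open>S\<close> on the manifold is the scalar curvature of \<open>g\<close>: it is computed by the
  coordinate formula in any chart.\<close>

definition is_scalar_curvature ::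
  "('m, 'e::euclidean_space) chart set \<Rightarrow> ('m, 'e) tensor2 \<Rightarrow> ('m \<Rightarrow> real) \<Rightarrow> bool" where
  "is_scalar_curvature \<A> g S \<longleftrightarrow>
     (\<forall>c\<in>\<A>. \<forall>q\<in>fst c. S q = scalar_curvature_at (g c) (snd c q))"


section \<open>Lie groups, actions and homogeneous spaces\<close>

definition lie_group ::
  "'g::{t2_space,second_countable_topology} monoid \<Rightarrow> ('g, 'f::euclidean_space) chart set \<Rightarrow> bool"
  where
  "lie_group G \<G> \<longleftrightarrow>
     group G \<and> carrier G = UNIV \<and> smooth_structure \<G> \<and>
     smooth_map (prod_atlas \<G> \<G>) \<G> (\<lambda>(a, b). a \<otimes>\<^bsub>G\<^esub> b) \<and>
     smooth_map \<G> \<G> (\<lambda>a. inv\<^bsub>G\<^esub> a)"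

definition smooth_action ::
  "'g::topological_space monoid \<Rightarrow> ('g, 'f::euclidean_space) chart set \<Rightarrow>
   ('m::topological_space, 'e::euclidean_space) chart set \<Rightarrow> ('g \<Rightarrow> 'm \<Rightarrow> 'm) \<Rightarrow> bool" where
  "smooth_action G \<G> \<A> act \<longleftrightarrow>
     group_action G UNIV act \<and> smooth_map (prod_atlas \<G> \<A>) \<A> (\<lambda>(a, q). act a q)"

text \<open>The manifold \<open>\<N>\<close> with base point \<open>z\<close> is the homogeneous space \<open>G/K\<close>: \<open>K\<close> is the stabilizer of
  \<open>z\<close> under a smooth transitive action, and the projection \<open>a \<mapsto> aK = act a z\<close> is a submersion (this
  characterizes the smooth structure of \<open>G/K\<close>; by equivariance it suffices to ask it at the
  identity).\<close>

definition homogeneous_space ::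
  "'g::topological_space monoid \<Rightarrow> ('g, 'f::euclidean_space) chart set \<Rightarrow> 'g set \<Rightarrow>
   ('n::{t2_space,second_countable_topology}, 'e::euclidean_space) chart set \<Rightarrow>
   ('g \<Rightarrow> 'n \<Rightarrow> 'n) \<Rightarrow> 'n \<Rightarrow> bool" where
  "homogeneous_space G \<G> K \<N> act z \<longleftrightarrow>
     smooth_structure \<N> \<and> smooth_action G \<G> \<N> act \<and> transitive_action G UNIV act \<and>
     K = stabilizer G act z \<and>
     (\<forall>c\<in>\<G>. \<forall>d\<in>\<N>. \<one>\<^bsub>G\<^esub> \<in> fst c \<and> z \<in> fst d \<longrightarrow>
        surj (tangent_map c d (\<lambda>a. act a z) \<one>\<^bsub>G\<^esub>))"


section \<open>The isotropy representation\<close>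

text \<open>The vector space \<open>\<g>\<close> is the tangent space of \<open>G\<close> at the identity; it is identified with the
  model space \<open>'f\<close> through a fixed chart \<open>c\<close> at the identity.\<close>

definition Ad ::
  "'g monoid \<Rightarrow> ('g, 'f::euclidean_space) chart \<Rightarrow> 'g \<Rightarrow> 'f \<Rightarrow> 'f" where
  "Ad G c k = tangent_map c c (\<lambda>a. k \<otimes>\<^bsub>G\<^esub> a \<otimes>\<^bsub>G\<^esub> inv\<^bsub>G\<^esub> k) \<one>\<^bsub>G\<^esub>"

text \<open>The Lie algebra of a closed subgroup: velocities at the identity of smooth curves in \<open>K\<close>.\<close>

definition lie_subalgebra ::
  "'g::topological_space monoid \<Rightarrow> ('g, 'f::euclidean_space) chart set \<Rightarrow> ('g, 'f) chart \<Rightarrow>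
   'g set \<Rightarrow> 'f set" where
  "lie_subalgebra G \<G> c K =
     {X. \<exists>\<gamma>. smooth_map {(UNIV, id :: real \<Rightarrow> real)} \<G> \<gamma> \<and> range \<gamma> \<subseteq> K \<and> \<gamma> 0 = \<one>\<^bsub>G\<^esub> \<and>
          ((snd c \<circ> \<gamma>) has_vector_derivative X) (at 0)}"

definition invariant_subspace :: "('k \<Rightarrow> 'f \<Rightarrow> 'f) \<Rightarrow> 'k set \<Rightarrow> 'f::real_vector set \<Rightarrow> bool" where
  "invariant_subspace \<rho> K W \<longleftrightarrow> subspace W \<and> (\<forall>k\<in>K. \<rho> k ` W \<subseteq> W)"

definition irreducible_subspace :: "('k \<Rightarrow> 'f \<Rightarrow> 'f) \<Rightarrow> 'k set \<Rightarrow> 'f::real_vector set \<Rightarrow> bool" where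
  "irreducible_subspace \<rho> K P \<longleftrightarrow>
     invariant_subspace \<rho> K P \<and> P \<noteq> {0} \<and>
     (\<forall>W. invariant_subspace \<rho> K W \<and> W \<subseteq> P \<longrightarrow> W = {0} \<or> W = P)"

definition equivalent_subspaces ::
  "('k \<Rightarrow> 'f \<Rightarrow> 'f) \<Rightarrow> 'k set \<Rightarrow> 'f::real_vector set \<Rightarrow> 'f set \<Rightarrow> bool" where
  "equivalent_subspaces \<rho> K P P' \<longleftrightarrow>
     (\<exists>L. linear L \<and> bij_betw L P P' \<and> (\<forall>k\<in>K. \<forall>X\<in>P. L (\<rho> k X) = \<rho> k (L X)))"

text \<open>The whole space is the direct sum of \<open>\<kk>\<close> and \<open>\<pp> 0, \<dots>, \<pp> m\<close>.\<close>

definition direct_sum_decomposition ::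
  "'f::real_vector set \<Rightarrow> nat \<Rightarrow> (nat \<Rightarrow> 'f set) \<Rightarrow> bool" where
  "direct_sum_decomposition \<kk> m \<pp> \<longleftrightarrow>
     (\<forall>X. \<exists>W\<in>\<kk>. \<exists>Z. (\<forall>i\<le>m. Z i \<in> \<pp> i) \<and> X = W + (\<Sum>i\<le>m. Z i)) \<and>
     (\<forall>W\<in>\<kk>. \<forall>Z. (\<forall>i\<le>m. Z i \<in> \<pp> i) \<and> W + (\<Sum>i\<le>m. Z i) = 0 \<longrightarrow>
        W = 0 \<and> (\<forall>i\<le>m. Z i = 0))"

definition isotropy_decomposition ::
  "'g::topological_space monoid \<Rightarrow> ('g, 'f::euclidean_space) chart set \<Rightarrow> ('g, 'f) chart \<Rightarrow>
   'g set \<Rightarrow> nat \<Rightarrow> (nat \<Rightarrow> 'f set) \<Rightarrow> bool" where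
  "isotropy_decomposition G \<G> c K m \<pp> \<longleftrightarrow>
     direct_sum_decomposition (lie_subalgebra G \<G> c K) m \<pp> \<and>
     (\<forall>i\<le>m. irreducible_subspace (Ad G c) K (\<pp> i))"

text \<open>An \<open>Ad(K)\<close>-invariant inner product on \<open>\<pp> 0 \<oplus> \<dots> \<oplus> \<pp> m\<close>; the values of \<open>Q\<close> off this subspace
  play no role.\<close>

definition invariant_inner_product ::
  "('k \<Rightarrow> 'f \<Rightarrow> 'f) \<Rightarrow> 'k set \<Rightarrow> nat \<Rightarrow> (nat \<Rightarrow> 'f::real_vector set) \<Rightarrow> ('f \<Rightarrow> 'f \<Rightarrow> real) \<Rightarrow> bool"
  where
  "invariant_inner_product \<rho> K m \<pp> Q \<longleftrightarrow>
     (let P = span (\<Union>i\<le>m. \<pp> i) in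
        bilinear Q \<and> (\<forall>X\<in>P. \<forall>Y\<in>P. Q X Y = Q Y X) \<and> (\<forall>X\<in>P. X \<noteq> 0 \<longrightarrow> Q X X > 0) \<and>
        (\<forall>k\<in>K. \<forall>X\<in>P. \<forall>Y\<in>P. Q (\<rho> k X) (\<rho> k Y) = Q X Y))"


section \<open>Homogeneous metrics and metrics of cohomogeneity one\<close>

text \<open>The tensor \<open>\<gamma>\<close> is the \<open>G\<close>-invariant Riemannian metric on \<open>G/K\<close> induced by the inner product
  \<open>\<Sum>\<^sub>i w\<^sub>i Q|\<pp>\<^sub>i\<close> on \<open>\<pp>\<^sub>0 \<oplus> \<dots> \<oplus> \<pp>\<^sub>m\<close>, which is identified with the tangent space of \<open>G/K\<close> at the base
  point by the differential of the projection.\<close>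

definition homogeneous_metric ::
  "'g monoid \<Rightarrow> ('g, 'f::euclidean_space) chart \<Rightarrow> ('n, 'e::euclidean_space) chart set \<Rightarrow>
   ('g \<Rightarrow> 'n \<Rightarrow> 'n) \<Rightarrow> 'n \<Rightarrow> nat \<Rightarrow> (nat \<Rightarrow> 'f set) \<Rightarrow> ('f \<Rightarrow> 'f \<Rightarrow> real) \<Rightarrow>
   (nat \<Rightarrow> real) \<Rightarrow> ('n, 'e) tensor2 \<Rightarrow> bool" where
  "homogeneous_metric G c \<N> act z m \<pp> Q w \<gamma> \<longleftrightarrow>
     riemannian_metric \<N> \<gamma> \<and> (\<forall>a\<in>carrier G. isometric \<N> \<gamma> (act a)) \<and>
     (\<forall>d\<in>\<N>. z \<in> fst d \<longrightarrow>
        (\<forall>X Y. (\<forall>i\<le>m. X i \<in> \<pp> i) \<and> (\<forall>i\<le>m. Y i \<in> \<pp> i) \<longrightarrow>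
           \<gamma> d (snd d z)
             (tangent_map c d (\<lambda>a. act a z) \<one>\<^bsub>G\<^esub> (\<Sum>i\<le>m. X i))
             (tangent_map c d (\<lambda>a. act a z) \<one>\<^bsub>G\<^esub> (\<Sum>i\<le>m. Y i))
           = (\<Sum>i\<le>m. w i * Q (X i) (Y i))))"

text \<open>For \<open>\<Phi> : I \<times> G/K \<rightarrow> M\<close>, the chart of \<open>M\<close> obtained by transporting \<open>id \<times> d\<close> along \<open>\<Phi>\<close>.\<close>

definition tube_chart ::
  "(real \<times> 'n \<Rightarrow> 'm) \<Rightarrow> real set \<Rightarrow> ('n, 'e) chart \<Rightarrow> ('m, real \<times> 'e) chart" where
  "tube_chart \<Phi> I d = (\<Phi> ` (I \<times> fst d), map_prod id (snd d) \<circ> inv_into (I \<times> UNIV) \<Phi>)"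

text \<open>The map \<open>\<Phi>\<close> is a \<open>G\<close>-equivariant diffeomorphism of \<open>I \<times> G/K\<close> onto an open subset of \<open>M\<close>. Since \<open>\<M>\<close> is
  a maximal atlas, the diffeomorphism property says that the transported charts belong to \<open>\<M>\<close>.\<close>

definition equivariant_tube ::
  "'g monoid \<Rightarrow> ('n, 'e::euclidean_space) chart set \<Rightarrow> ('g \<Rightarrow> 'n \<Rightarrow> 'n) \<Rightarrow>
   ('m, real \<times> 'e) chart set \<Rightarrow> ('g \<Rightarrow> 'm \<Rightarrow> 'm) \<Rightarrow> real set \<Rightarrow> (real \<times> 'n \<Rightarrow> 'm) \<Rightarrow> bool" where
  "equivariant_tube G \<N> actN \<M> actM I \<Phi> \<longleftrightarrow>
     inj_on \<Phi> (I \<times> UNIV) \<and> (\<forall>d\<in>\<N>. tube_chart \<Phi> I d \<in> \<M>) \<and>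
     (\<forall>a\<in>carrier G. \<forall>x\<in>I. \<forall>q. \<Phi> (x, actN a q) = actM a (\<Phi> (x, q)))"

text \<open>The isotropy group \<open>K\<close> is principal: it is, up to conjugation, contained in every isotropy
  group.\<close>

definition principal_isotropy ::
  "'g monoid \<Rightarrow> ('g \<Rightarrow> 'm \<Rightarrow> 'm) \<Rightarrow> 'g set \<Rightarrow> bool" where
  "principal_isotropy G act K \<longleftrightarrow>
     (\<forall>q. \<exists>a\<in>carrier G. (\<lambda>k. a \<otimes>\<^bsub>G\<^esub> k \<otimes>\<^bsub>G\<^esub> inv\<^bsub>G\<^esub> a) ` K \<subseteq> stabilizer G act q)"

text \<open>On the tube, \<open>g = h\<^sup>-\<^sup>1 dx\<^sup>2 + h Q|\<pp>\<^sub>0 + \<Sum>\<^sub>i A\<^sub>i Q|\<pp>\<^sub>i\<close> with \<open>i = 1, \<dots>, m\<close>.\<close>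

definition cohomogeneity_one_metric ::
  "'g monoid \<Rightarrow> ('g, 'f::euclidean_space) chart \<Rightarrow> ('n, 'e::euclidean_space) chart set \<Rightarrow>
   ('g \<Rightarrow> 'n \<Rightarrow> 'n) \<Rightarrow> 'n \<Rightarrow> nat \<Rightarrow> (nat \<Rightarrow> 'f set) \<Rightarrow> ('f \<Rightarrow> 'f \<Rightarrow> real) \<Rightarrow>
   real set \<Rightarrow> (real \<times> 'n \<Rightarrow> 'm) \<Rightarrow> (real \<Rightarrow> real) \<Rightarrow> (nat \<Rightarrow> real \<Rightarrow> real) \<Rightarrow>
   ('m, real \<times> 'e) tensor2 \<Rightarrow> bool" where
  "cohomogeneity_one_metric G c \<N> act z m \<pp> Q I \<Phi> h A g \<longleftrightarrow>
     (\<forall>x\<in>I. \<exists>\<gamma>. homogeneous_metric G c \<N> act z m \<pp> Q ((\<lambda>j. A j x)(0 := h x)) \<gamma> \<and>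
        (\<forall>d\<in>\<N>. \<forall>y\<in>snd d ` fst d. \<forall>s t u v.
           g (tube_chart \<Phi> I d) (x, y) (s, u) (t, v) = 1 / h x * s * t + \<gamma> d y u v))"

text \<open>The decomposition of the scalar curvature of the homogeneous metrics
  \<open>\<eta> Q|\<pp>\<^sub>0 + \<Sum>\<^sub>i \<alpha>\<^sub>i Q|\<pp>\<^sub>i\<close> on \<open>G/K\<close> into the term
  \<open>- \<eta> \<Sum>\<^sub>j d\<^sub>j/4 b\<^sub>j\<^sup>2/\<alpha>\<^sub>j\<^sup>2\<close> and a part \<open>Sstar \<alpha>\<close> that does not involve \<open>\<eta>\<close>. As it is required for all
  positive \<open>\<eta>\<close>, \<open>\<alpha>\<^sub>1, \<dots>, \<alpha>\<^sub>m\<close>, it determines the numbers \<open>b\<^sub>j\<^sup>2\<close> and the function \<open>Sstar\<close> of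
  \<open>\<alpha>\<^sub>1, \<dots>, \<alpha>\<^sub>m\<close>.\<close>

definition orbit_curvature_decomposition ::
  "'g monoid \<Rightarrow> ('g, 'f::euclidean_space) chart \<Rightarrow> ('n, 'e::euclidean_space) chart set \<Rightarrow>
   ('g \<Rightarrow> 'n \<Rightarrow> 'n) \<Rightarrow> 'n \<Rightarrow> nat \<Rightarrow> (nat \<Rightarrow> 'f set) \<Rightarrow> ('f \<Rightarrow> 'f \<Rightarrow> real) \<Rightarrow>
   (nat \<Rightarrow> real) \<Rightarrow> ((nat \<Rightarrow> real) \<Rightarrow> real) \<Rightarrow> bool" where
  "orbit_curvature_decomposition G c \<N> act z m \<pp> Q b Sstar \<longleftrightarrow>
     (\<forall>\<eta> \<alpha> \<gamma>. \<eta> > 0 \<and> (\<forall>j\<in>{1..m}. \<alpha> j > 0) \<and>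
        homogeneous_metric G c \<N> act z m \<pp> Q (\<alpha>(0 := \<eta>)) \<gamma> \<longrightarrow>
        is_scalar_curvature \<N> \<gamma>
          (\<lambda>_. - \<eta> * (\<Sum>j=1..m. real (dim (\<pp> j)) / 4 * ((b j)\<^sup>2 / (\<alpha> j)\<^sup>2)) + Sstar \<alpha>))"

end

theory Submission
  imports Defs
begin

text \<open>
  In a chart of the form \<open>id \<times> d\<close> the metric is \<open>dx\<^sup>2/h + \<gamma>\<^sub>x\<close>. With \<open>P = \<gamma>\<^sub>x\<^sup>-\<^sup>1 \<partial>\<^sub>x\<gamma>\<^sub>x\<close> the scalar
  curvature is that of the orbit minus
  \<open>h'/2 tr P + h tr P' + h/4 tr P\<^sup>2 + h/4 (tr P)\<^sup>2\<close>. Over the base point of \<open>G/K\<close> the endomorphism \<open>P\<close>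
  is diagonal with respect to \<open>\<pp>\<^sub>0 \<oplus> \<dots> \<oplus> \<pp>\<^sub>m\<close>, with eigenvalues \<open>h'/h\<close> and \<open>A\<^sub>i'/A\<^sub>i\<close>. Since \<open>\<pp>\<^sub>0\<close> has
  dimension one, the terms in \<open>h'\<^sup>2/h\<close> cancel, and what remains is
  \<open>(h V\<^sup>1\<^sup>/\<^sup>2)'' / V\<^sup>1\<^sup>/\<^sup>2 = S\<^sup>* - S - h/4 \<Sum>\<^sub>j d\<^sub>j (2 A\<^sub>j''/A\<^sub>j - (A\<^sub>j'/A\<^sub>j)\<^sup>2 + b\<^sub>j\<^sup>2/A\<^sub>j\<^sup>2)\<close>.
  The function \<open>h\<close> is an iterated integral as claimed if and only if the last sum vanishes.
\<close>

section \<open>Musical isomorphisms\<close>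

definition inner_form :: "('e::euclidean_space \<Rightarrow> 'e \<Rightarrow> real) \<Rightarrow> bool" where
  "inner_form B \<longleftrightarrow> bilinear B \<and> (\<forall>u v. B u v = B v u) \<and> (\<forall>u. u \<noteq> 0 \<longrightarrow> B u u > 0)"

lemma linear_expand:
  fixes f :: "'e::euclidean_space \<Rightarrow> 'b::real_vector"
  assumes "linear f"
  shows "f u = (\<Sum>b\<in>Basis. (u \<bullet> b) *\<^sub>R f b)"
proof -
  have "f u = f (\<Sum>b\<in>Basis. (u \<bullet> b) *\<^sub>R b)"
    by (simp add: euclidean_representation)
  also have "\<dots> = (\<Sum>b\<in>Basis. (u \<bullet> b) *\<^sub>R f b)"
    by (simp add: linear_sum[OF assms] linear_scale[OF assms])
  finally show ?thesis .
qed

lemma linear_riesz: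
  fixes \<alpha> :: "'e::euclidean_space \<Rightarrow> real"
  assumes "linear \<alpha>"
  shows "(\<Sum>b\<in>Basis. \<alpha> b *\<^sub>R b) \<bullet> w = \<alpha> w"
  by (subst (2) linear_expand[OF assms]) (simp add: inner_sum_left mult.commute inner_commute[of w])

lemma inner_form_linear:
  assumes "inner_form B"
  shows "linear (B u)" "linear (\<lambda>u. B u v)"
  using assms by (auto simp: inner_form_def bilinear_def)

lemma inner_form_cancel:
  assumes "inner_form B" and "\<And>w. B z w = B z' w"
  shows "z = z'"
proof (rule ccontr)
  assume "z \<noteq> z'"
  then have "B (z - z') (z - z') > 0"
    using assms(1) by (simp add: inner_form_def)
  moreover have "B (z - z') (z - z') = B z (z - z') - B z' (z - z')"
    by (rule linear_diff[OF inner_form_linear(2)[OF assms(1)]])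
  ultimately show False
    by (simp add: assms(2))
qed

lemma sharp_eqI:
  assumes "inner_form B" and "\<And>w. B z w = \<alpha> w"
  shows "sharp B \<alpha> = z"
  unfolding sharp_def
  using assms by (intro the_equality) (auto intro: inner_form_cancel)

text \<open>\<open>sharp\<close> is a definite description, so existence has to be shown. Positive
  definiteness makes the map \<open>L\<close> from \<open>u\<close> to the Riesz vector of
  \<open>B u\<close> injective, hence surjective in finite dimension.\<close>

lemma sharp_inner_form:
  assumes "inner_form B" "linear \<alpha>"
  shows "B (sharp B \<alpha>) w = \<alpha> w"
proof -
  define L where "L u = (\<Sum>b\<in>Basis. B u b *\<^sub>R b)" for u
  have L_inner: "L u \<bullet> w = B u w" for u w
    unfolding L_def by (rule linear_riesz[OF inner_form_linear(1)[OF assms(1)]])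
  have "linear L"
    unfolding L_def
    by (intro linearI)
       (simp_all add: linear_add[OF inner_form_linear(2)[OF assms(1)]] scaleR_add_left sum.distrib
        linear_scale[OF inner_form_linear(2)[OF assms(1)]] scaleR_sum_right)
  moreover have "inj L"
    by (intro injI inner_form_cancel[OF assms(1)]) (metis L_inner)
  ultimately have "surj L"
    by (simp add: linear_injective_imp_surjective)
  then obtain z where "L z = (\<Sum>b\<in>Basis. \<alpha> b *\<^sub>R b)"
    by (metis surjE)
  then have "B z w = \<alpha> w" for w
    using linear_riesz[OF assms(2)] L_inner by metis
  then show ?thesis
    using sharp_eqI[OF assms(1)] by metis
qed

text \<open>The sum and the multiple of representing vectors satisfy the equation that determines
  the representing vector uniquely.\<close>

lemma linear_sharp:
  assumes "inner_form B" "\<And>u. linear (\<alpha> u)" "\<And>w. linear (\<lambda>u. \<alpha> u w)"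
  shows "linear (\<lambda>u. sharp B (\<alpha> u))"
proof (rule linearI)
  note l = linear_add[OF inner_form_linear(2)[OF assms(1)]]
    linear_scale[OF inner_form_linear(2)[OF assms(1)]]
    linear_add[OF assms(3)] linear_scale[OF assms(3)]
  show "sharp B (\<alpha> (u + v)) = sharp B (\<alpha> u) + sharp B (\<alpha> v)" for u v
    by (intro sharp_eqI[OF assms(1)]) (simp add: l sharp_inner_form[OF assms(1,2)])
  show "sharp B (\<alpha> (r *\<^sub>R u)) = r *\<^sub>R sharp B (\<alpha> u)" for r u
    by (intro sharp_eqI[OF assms(1)]) (simp add: l sharp_inner_form[OF assms(1,2)])
qed

text \<open>The inverse function theorem for \<open>(q, s) \<mapsto> (q, B\<^sub>q(s, \<cdot>))\<close>.\<close>

lemma differentiable_sharp: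
  fixes B :: "'a::euclidean_space \<Rightarrow> 'e::euclidean_space \<Rightarrow> 'e \<Rightarrow> real"
  assumes S: "open S" "p \<in> S"
    and B: "\<And>q. q \<in> S \<Longrightarrow> inner_form (B q)"
    and dB: "\<And>q u v. q \<in> S \<Longrightarrow> (\<lambda>q. B q u v) differentiable (at q)"
    and \<alpha>: "\<And>q. q \<in> S \<Longrightarrow> linear (\<alpha> q)"
    and d\<alpha>: "\<And>w. (\<lambda>q. \<alpha> q w) differentiable (at p)"
  shows "(\<lambda>q. sharp (B q) (\<alpha> q)) differentiable (at p)"
proof -
  \<comment> \<open>The form \<open>B q s\<close> is stored as the vector of its values on
    \<open>Basis\<close>, and \<open>s\<close> is expanded in \<open>Basis\<close> too. Only the
    scalar functions \<open>B q b e\<close> on basis vectors then have to be differentiated. On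
    \<open>S\<close> the inner sum is \<open>B q s e\<close>.\<close>
  define F where "F = (\<lambda>(q, s). (q, \<Sum>e\<in>Basis. (\<Sum>b\<in>Basis. (s \<bullet> b) * B q b e) *\<^sub>R e))"
  define r where "r q = (\<Sum>e\<in>Basis. \<alpha> q e *\<^sub>R e)" for q
  define g where "g = (\<lambda>(q, r). (q, sharp (B q) (\<lambda>w. r \<bullet> w)))"
  define s0 where "s0 = sharp (B p) (\<alpha> p)"
  define DB where "DB b e = frechet_derivative (\<lambda>q. B q b e) (at p)" for b e
  define F' where "F' = (\<lambda>(dq, ds). (dq, \<Sum>e\<in>Basis. (\<Sum>b\<in>Basis. (ds \<bullet> b) * B p b e + (s0 \<bullet> b) * DB b e dq) *\<^sub>R e))"
  \<comment> \<open>Right inverse of \<open>F'\<close>: from (dq, dr) the contribution of the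
    variation of \<open>B\<close> in direction dq, at the fixed vector \<open>s0\<close>, is moved
    to the right-hand side, and the remaining form is represented by \<open>B p\<close>.\<close>
  define g' where "g' = (\<lambda>(dq, dr). (dq, sharp (B p)
      (\<lambda>w. dr \<bullet> w - (\<Sum>e\<in>Basis. (w \<bullet> e) * (\<Sum>b\<in>Basis. (s0 \<bullet> b) * DB b e dq)))))"
  have B_sum: "(\<Sum>b\<in>Basis. (s \<bullet> b) * B q b e) = B q s e" if "q \<in> S" for q s e
    using linear_expand[OF inner_form_linear(2)[OF B[OF that]], where u = s and v1 = e] by simp
  have r_inner: "r q \<bullet> w = \<alpha> q w" if "q \<in> S" for q w
    unfolding r_def by (rule linear_riesz[OF \<alpha>[OF that]])
  have lin: "linear (\<lambda>w. r \<bullet> w)" for r :: 'e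
    by (rule bounded_linear.linear[OF bounded_linear_inner_right])
  have F_g: "F (g (p, r p)) = (p, r p)" and "g (p, r p) = (p, s0)"
  proof -
    show "g (p, r p) = (p, s0)"
      by (simp add: g_def r_inner[OF S(2), THEN ext] s0_def)
    then show "F (g (p, r p)) = (p, r p)"
      by (simp add: F_def B_sum[OF S(2)] s0_def r_def sharp_inner_form[OF B \<alpha>] S(2))
  qed
  have "(g has_derivative g') (at (p, r p))"
  proof (rule has_derivative_inverse_strong_x[where S = "S \<times> UNIV" and f = F and f' = F'])
    show "open (S \<times> (UNIV :: 'e set))"
      using S by (simp add: open_Times)
    show "g (p, r p) \<in> S \<times> UNIV"
      using S(2) by (simp add: g_def)
    have cB: "continuous_on S (\<lambda>q. B q u v)" for u v
      using dB by (meson continuous_at_imp_continuous_on differentiable_imp_continuous_within)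
    have "continuous_on (S \<times> UNIV) (\<lambda>x. B (fst x) u v)" for u v
      by (rule continuous_on_compose2[OF cB[of u v] continuous_on_fst[OF continuous_on_id]]) auto
    then show "continuous_on (S \<times> UNIV) F"
      unfolding F_def case_prod_beta by (intro continuous_intros)
    show "g (F x) = x" if "x \<in> S \<times> UNIV" for x
    proof -
      obtain q s where x: "x = (q, s)" "q \<in> S"
        using \<open>x \<in> S \<times> UNIV\<close> by auto
      have "(\<bullet>) (\<Sum>e\<in>Basis. B q s e *\<^sub>R e) = B q s"
        by (rule ext, rule linear_riesz[OF inner_form_linear(1)[OF B[OF x(2)]]])
      then show ?thesis
        using sharp_eqI[OF B[OF x(2)], of s "B q s"] by (simp add: F_def g_def x B_sum)
    qed
    have "((\<lambda>q. B q u v) has_derivative DB u v) (at p)" for u v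
      using dB[OF S(2)] by (simp add: DB_def frechet_derivative_works)
    then have "((\<lambda>x. B (fst x) u v) has_derivative (\<lambda>d. DB u v (fst d))) (at (p, s0))" for u v
      by (intro has_derivative_compose[where g = "\<lambda>q. B q u v" and f = fst])
         (auto intro!: derivative_eq_intros)
    then have "(F has_derivative F') (at (p, s0))"
      unfolding F_def F'_def case_prod_beta
      by (auto intro!: derivative_eq_intros sum.cong simp: fun_eq_iff algebra_simps)
    then show "(F has_derivative F') (at (g (p, r p)))"
      by (simp add: \<open>g (p, r p) = (p, s0)\<close>)
    show "F' \<circ> g' = id"
    proof
      fix x :: "'a \<times> 'e"
      obtain dq dr where x: "x = (dq, dr)"
        by (cases x)
      define \<beta> where "\<beta> w = dr \<bullet> w - (\<Sum>e\<in>Basis. (w \<bullet> e) * (\<Sum>b\<in>Basis. (s0 \<bullet> b) * DB b e dq))" for w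
      have "linear \<beta>"
        unfolding \<beta>_def
        by (intro linearI) (simp_all add: inner_simps sum.distrib algebra_simps sum_distrib_left)
      then have "B p (sharp (B p) \<beta>) e = \<beta> e" for e
        using sharp_inner_form[OF B[OF S(2)]] by blast
      moreover have "\<beta> e = dr \<bullet> e - (\<Sum>b\<in>Basis. (s0 \<bullet> b) * DB b e dq)" if "e \<in> Basis" for e
        unfolding \<beta>_def using that by (simp add: inner_Basis if_distrib[of "\<lambda>x. x * _"] sum.delta cong: if_cong)
      moreover have "g' x = (dq, sharp (B p) \<beta>)"
        by (simp add: g'_def x \<beta>_def[abs_def])
      ultimately show "(F' \<circ> g') x = id x"
        by (simp add: F'_def x sum.distrib B_sum[OF S(2)] euclidean_representation)
    qed
    show "F (g (p, r p)) = (p, r p)"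
      by (rule F_g)
  qed
  moreover have "(\<lambda>q. (q, r q)) differentiable (at p)"
    unfolding r_def using d\<alpha> by (intro differentiable_Pair) auto
  ultimately have "(g \<circ> (\<lambda>q. (q, r q))) differentiable (at p)"
    by (intro differentiable_chain_at) (auto simp: differentiable_def)
  then have "(\<lambda>q. snd (g (q, r q))) differentiable (at p)"
    unfolding o_def differentiable_def by (elim exE) (rule exI, erule has_derivative_snd)
  then have "(\<lambda>q. sharp (B q) (\<lambda>w. r q \<bullet> w)) differentiable (at p)"
    by (simp add: g_def)
  then show ?thesis
    unfolding differentiable_def
    by (rule ex_forward, elim has_derivative_transform_within_open[OF _ S])
       (simp add: r_inner[THEN ext])
qed

section \<open>Christoffel symbols and curvature of a smooth metric\<close>

lemma smooth_on_differentiable: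
  "smooth_on S f \<Longrightarrow> x \<in> S \<Longrightarrow> f differentiable (at x)"
  unfolding smooth_on_def using Ck_on.simps(2) by blast

lemma smooth_on_frechet_derivative:
  "smooth_on S f \<Longrightarrow> smooth_on S (\<lambda>x. frechet_derivative f (at x) v)"
  unfolding smooth_on_def using Ck_on.simps(2) by blast

text \<open>On \<open>I\<close> the function \<open>deriv f\<close> agrees with the Frechet
  derivative in direction 1, which is again smooth.\<close>

lemma smooth_on_real_derivs:
  fixes f :: "real \<Rightarrow> real"
  assumes "open I" "smooth_on I f" "x \<in> I"
  shows "(f has_real_derivative deriv f x) (at x)"
    "(deriv f has_real_derivative deriv (deriv f) x) (at x)"
proof -
  have d: "(f has_real_derivative deriv f z) (at z)" if "z \<in> I" for z
    using smooth_on_differentiable[OF assms(2) that] DERIV_deriv_iff_real_differentiable by blast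
  show "(f has_real_derivative deriv f x) (at x)"
    by (rule d[OF assms(3)])
  have "(\<lambda>z. frechet_derivative f (at z) 1) differentiable (at x)"
    by (rule smooth_on_differentiable[OF smooth_on_frechet_derivative[OF assms(2)] assms(3)])
  moreover have "frechet_derivative f (at z) 1 = deriv f z" if "z \<in> I" for z
    using d[OF that] by (simp add: has_field_derivative_def frechet_derivative_at[symmetric])
  ultimately have "deriv f differentiable (at x)"
    unfolding differentiable_def
    by (elim ex_forward has_derivative_transform_within_open[OF _ assms(1,3)])
  then show "(deriv f has_real_derivative deriv (deriv f) x) (at x)"
    using DERIV_deriv_iff_real_differentiable by blast
qed

text \<open>Additivity and homogeneity of \<open>F q\<close> are identities in \<open>q\<close> on
  the open set \<open>S\<close>, so they can be differentiated at \<open>p\<close>.\<close>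

lemma linear_frechet_derivative_family:
  fixes F :: "'a::real_normed_vector \<Rightarrow> 'e::real_vector \<Rightarrow> 'b::real_normed_vector"
  assumes S: "open S" "p \<in> S" and F: "\<And>q. q \<in> S \<Longrightarrow> linear (F q)"
    and dF: "\<And>u. (\<lambda>q. F q u) differentiable (at p)"
  shows "linear (\<lambda>u. frechet_derivative (\<lambda>q. F q u) (at p) X)"
proof (rule linearI)
  have d: "((\<lambda>q. F q u) has_derivative frechet_derivative (\<lambda>q. F q u) (at p)) (at p)" for u
    using dF by (simp add: frechet_derivative_works)
  show "frechet_derivative (\<lambda>q. F q (u + v)) (at p) X
    = frechet_derivative (\<lambda>q. F q u) (at p) X + frechet_derivative (\<lambda>q. F q v) (at p) X" for u v
  proof -
    have "((\<lambda>q. F q (u + v)) has_derivative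
      (\<lambda>X. frechet_derivative (\<lambda>q. F q u) (at p) X + frechet_derivative (\<lambda>q. F q v) (at p) X)) (at p)"
      by (rule has_derivative_transform_within_open[OF has_derivative_add[OF d d] S])
         (simp add: linear_add[OF F])
    then show ?thesis
      by (simp add: frechet_derivative_at[symmetric])
  qed
  show "frechet_derivative (\<lambda>q. F q (r *\<^sub>R u)) (at p) X
    = r *\<^sub>R frechet_derivative (\<lambda>q. F q u) (at p) X" for r u
  proof -
    have "((\<lambda>q. F q (r *\<^sub>R u)) has_derivative
      (\<lambda>X. r *\<^sub>R frechet_derivative (\<lambda>q. F q u) (at p) X)) (at p)"
      by (rule has_derivative_transform_within_open[OF has_derivative_scaleR_right[OF d] S])
         (simp add: linear_scale[OF F])
    then show ?thesis
      by (simp add: frechet_derivative_at[symmetric])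
  qed
qed

lemma frechet_derivative_slice:
  fixes f :: "'a::real_normed_vector \<times> 'b::real_normed_vector \<Rightarrow> 'c::real_normed_vector"
  assumes "f differentiable (at (x, y))"
  shows "((\<lambda>z. f (x, z)) has_derivative (\<lambda>w. frechet_derivative f (at (x, y)) (0, w))) (at y)"
    and "((\<lambda>t. f (t, y)) has_derivative (\<lambda>s. frechet_derivative f (at (x, y)) (s, 0))) (at x)"
proof -
  have f: "(f has_derivative frechet_derivative f (at (x, y))) (at (x, y))"
    using assms by (simp add: frechet_derivative_works)
  show "((\<lambda>z. f (x, z)) has_derivative (\<lambda>w. frechet_derivative f (at (x, y)) (0, w))) (at y)"
    by (rule has_derivative_compose[where g = f and f = "\<lambda>z. (x, z)", OF _ f])
       (auto intro!: derivative_eq_intros)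
  show "((\<lambda>t. f (t, y)) has_derivative (\<lambda>s. frechet_derivative f (at (x, y)) (s, 0))) (at x)"
    by (rule has_derivative_compose[where g = f and f = "\<lambda>t. (t, y)", OF _ f])
       (auto intro!: derivative_eq_intros)
qed

section \<open>The connection and curvature of a metric on an open set\<close>

locale smooth_metric =
  fixes S :: "'e::euclidean_space set" and g :: "'e \<Rightarrow> 'e \<Rightarrow> 'e \<Rightarrow> real"
  assumes open_S: "open S" and inner_form_g: "\<And>p. p \<in> S \<Longrightarrow> inner_form (g p)"
    and smooth_g: "\<And>u v. smooth_on S (\<lambda>p. g p u v)"
begin

abbreviation (input) Dg where "Dg p X u v \<equiv> frechet_derivative (\<lambda>q. g q u v) (at p) X"

lemma g_sym: "p \<in> S \<Longrightarrow> g p u v = g p v u"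
  using inner_form_g by (simp add: inner_form_def)

lemma differentiable_g: "p \<in> S \<Longrightarrow> (\<lambda>q. g q u v) differentiable (at p)"
  and differentiable_Dg: "p \<in> S \<Longrightarrow> (\<lambda>q. Dg q X u v) differentiable (at p)"
  using smooth_g smooth_on_differentiable smooth_on_frechet_derivative by blast+

lemma linear_Dg:
  assumes "p \<in> S"
  shows "linear (\<lambda>X. Dg p X u v)" "linear (\<lambda>u. Dg p X u v)" "linear (\<lambda>v. Dg p X u v)"
proof -
  show "linear (\<lambda>X. Dg p X u v)"
    by (rule linear_frechet_derivative[OF differentiable_g[OF assms]])
  show "linear (\<lambda>u. Dg p X u v)"
    by (rule linear_frechet_derivative_family[OF open_S assms _ differentiable_g[OF assms]])
       (rule inner_form_linear[OF inner_form_g])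
  show "linear (\<lambda>v. Dg p X u v)"
    by (rule linear_frechet_derivative_family[OF open_S assms _ differentiable_g[OF assms]])
       (rule inner_form_linear[OF inner_form_g])
qed

text \<open>This is the form whose \<open>sharp\<close> is the Christoffel symbol. Linearity in
  \<open>w\<close> makes \<open>sharp\<close> well defined; linearity in \<open>u\<close> and
  \<open>v\<close> makes \<open>christoffel\<close> bilinear.\<close>

lemma linear_koszul:
  assumes "p \<in> S"
  shows "linear (\<lambda>w. (Dg p u v w + Dg p v u w - Dg p w u v) / 2)"
    "linear (\<lambda>u. (Dg p u v w + Dg p v u w - Dg p w u v) / 2)"
    "linear (\<lambda>v. (Dg p u v w + Dg p v u w - Dg p w u v) / 2)"
  using linear_Dg[OF assms] by (auto simp: linear_iff add_divide_distrib diff_divide_distrib algebra_simps)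

lemma linear_christoffel:
  assumes "p \<in> S"
  shows "linear (\<lambda>v. christoffel g p u v)" "linear (\<lambda>u. christoffel g p u v)"
  unfolding christoffel_def
  using linear_koszul[OF assms] by (auto intro!: linear_sharp[OF inner_form_g[OF assms]])

text \<open>The definition of \<open>curvature\<close> differentiates \<open>christoffel\<close>,
  and a Frechet derivative is meaningful only once differentiability is known. It comes from
  \<open>differentiable_sharp\<close>, since both the metric and the Koszul form vary
  differentiably.\<close>

lemma differentiable_christoffel:
  assumes "p \<in> S"
  shows "(\<lambda>q. christoffel g q u v) differentiable (at p)"
  unfolding christoffel_def
  by (rule differentiable_sharp[OF open_S assms inner_form_g differentiable_g linear_koszul(1)])
     (auto intro!: derivative_intros differentiable_Dg[OF assms])

lemma linear_curvature:
  assumes "p \<in> S"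
  shows "linear (curvature g p u v)"
proof -
  note D = linear_frechet_derivative_family[OF open_S assms linear_christoffel(1)
      differentiable_christoffel[OF assms]]
  have "linear (\<lambda>w. christoffel g p u (christoffel g p v w))" for u v
    using linear_compose[OF linear_christoffel(1)[OF assms] linear_christoffel(1)[OF assms]]
    by (simp add: o_def)
  then show ?thesis
    unfolding curvature_def[abs_def] by (intro linear_compose_add linear_compose_sub D)
qed

lemma linear_ricci:
  assumes "p \<in> S"
  shows "linear (ricci g p v)"
proof -
  have "linear (\<lambda>w. curvature g p e v w \<bullet> e)" for e
    using linear_curvature[OF assms, of e v] by (simp add: linear_iff inner_simps)
  then show ?thesis
    unfolding ricci_def[abs_def] by (intro linear_compose_sum) auto
qed

end

section \<open>One-parameter families of metrics\<close>

lemma linear_Pair_0: "linear (\<lambda>u. (0 :: 'a::real_vector, u :: 'b::real_vector))"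
  by (simp add: linear_iff)

definition lin_trace :: "('e::euclidean_space \<Rightarrow> 'e) \<Rightarrow> real" where
  "lin_trace f = (\<Sum>e\<in>Basis. f e \<bullet> e)"

lemma sum_Basis_real_prod:
  fixes f :: "real \<times> 'e::euclidean_space \<Rightarrow> 'b::comm_monoid_add"
  shows "(\<Sum>E\<in>Basis. f E) = f (1, 0) + (\<Sum>e\<in>Basis. f (0, e))"
proof -
  have "(1, 0) \<notin> Pair (0 :: real) ` (Basis :: 'e set)"
    by auto
  then show ?thesis
    by (simp add: Basis_prod_def sum.reindex inj_on_def)
qed

lemma has_derivative_fst_real:
  assumes "(f has_real_derivative d) (at (fst p))"
  shows "((\<lambda>q. f (fst q)) has_derivative (\<lambda>X. d * fst X)) (at p)"
  using assms unfolding has_field_derivative_def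
  by (intro has_derivative_compose[where g = f and f = fst]) (auto intro!: derivative_eq_intros)

text \<open>A chart of product form in which the metric is block diagonal. Each slice metric is
  smooth in the \<open>U\<close> directions; regularity of \<open>\<gamma>\<close> in the parameter
  \<open>x\<close> is inherited from the total metric.\<close>

locale metric_family = total: smooth_metric "I \<times> U" g
  for I :: "real set" and U :: "'e::euclidean_space set"
    and g :: "real \<times> 'e \<Rightarrow> real \<times> 'e \<Rightarrow> real \<times> 'e \<Rightarrow> real" +
  fixes \<gamma> :: "real \<Rightarrow> 'e \<Rightarrow> 'e \<Rightarrow> 'e \<Rightarrow> real" and h :: "real \<Rightarrow> real"
  assumes open_I: "open I"
    and slice: "\<And>x. x \<in> I \<Longrightarrow> smooth_metric U (\<gamma> x)"
    and smooth_h: "smooth_on I h" and h_pos: "\<And>x. x \<in> I \<Longrightarrow> h x > 0"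
    and g_eq: "\<And>x y s t u v. x \<in> I \<Longrightarrow> y \<in> U \<Longrightarrow>
      g (x, y) (s, u) (t, v) = s * t / h x + \<gamma> x y u v"
begin

text \<open>The slice metric is read off from the total metric, so that it is jointly differentiable
  in the parameter and the point.\<close>

abbreviation (input) B where "B p u v \<equiv> g p (0, u) (0, v)"
abbreviation (input) D where "D p X u v \<equiv> frechet_derivative (\<lambda>q. B q u v) (at p) X"

text \<open>The endomorphism P of the overview. The unit normal of a slice is sqrt(h) times the
  coordinate field of \<open>x\<close>, so up to sign the shape operator of the slice is sqrt(h)/2
  times P.\<close>

definition shape :: "real \<times> 'e \<Rightarrow> 'e \<Rightarrow> 'e" where
  "shape p u = sharp (B p) (D p (1, 0) u)"

lemma \<gamma>_eq: "x \<in> I \<Longrightarrow> y \<in> U \<Longrightarrow> \<gamma> x y u v = B (x, y) u v"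
  by (simp add: g_eq)

lemma inner_form_B:
  assumes "p \<in> I \<times> U"
  shows "inner_form (B p)"
proof -
  obtain x y where p: "p = (x, y)" "x \<in> I" "y \<in> U"
    using assms by auto
  have "inner_form (\<gamma> x y)"
    using smooth_metric.inner_form_g[OF slice] p by blast
  moreover have "\<gamma> x y = B p"
    using p by (simp add: \<gamma>_eq fun_eq_iff)
  ultimately show ?thesis
    by simp
qed

lemma sharp_\<gamma>: "x \<in> I \<Longrightarrow> y \<in> U \<Longrightarrow> sharp (\<gamma> x y) = sharp (B (x, y))"
  by (intro arg_cong[where f = sharp] ext) (simp add: \<gamma>_eq)

lemmas B_add = linear_add[OF inner_form_linear(1)[OF inner_form_B]]
    linear_add[OF inner_form_linear(2)[OF inner_form_B]]
  and B_scale = linear_scale[OF inner_form_linear(1)[OF inner_form_B]]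
    linear_scale[OF inner_form_linear(2)[OF inner_form_B]]

lemma linear_D:
  assumes "p \<in> I \<times> U"
  shows "linear (\<lambda>X. D p X u v)" "linear (\<lambda>u. D p X u v)" "linear (\<lambda>v. D p X u v)"
proof -
  show "linear (\<lambda>X. D p X u v)" "linear (\<lambda>u. D p X u v)" "linear (\<lambda>v. D p X u v)"
    using total.linear_Dg(1)[OF assms] linear_compose[OF linear_Pair_0 total.linear_Dg(2)[OF assms]]
      linear_compose[OF linear_Pair_0 total.linear_Dg(3)[OF assms]]
    by (simp_all add: o_def)
qed

lemma D_zero: "p \<in> I \<times> U \<Longrightarrow> D p X 0 v = 0" "p \<in> I \<times> U \<Longrightarrow> D p X u 0 = 0"
  and D_scale: "p \<in> I \<times> U \<Longrightarrow> D p (1, 0) u (r *\<^sub>R v) = r * D p (1, 0) u v"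
  by (fact linear_0[OF linear_D(2)] linear_0[OF linear_D(3)]
      linear_scale[OF linear_D(3), unfolded real_scaleR_def])+

lemma D_direction:
  assumes "p \<in> I \<times> U"
  shows "D p (s, u) v w = s * D p (1, 0) v w + D p (0, u) v w"
proof -
  have "(s, u) = s *\<^sub>R (1, 0) + (0, u)"
    by simp
  then show ?thesis
    by (metis linear_add[OF linear_D(1)[OF assms]] linear_scale[OF linear_D(1)[OF assms]] real_scaleR_def)
qed

lemma shape_eq: "p \<in> I \<times> U \<Longrightarrow> B p (shape p u) v = D p (1, 0) u v"
  unfolding shape_def using sharp_inner_form[OF inner_form_B linear_D(3)] .

lemma D_sym: "p \<in> I \<times> U \<Longrightarrow> D p X u v = D p X v u"
  by (rule arg_cong[where f = "\<lambda>f. f X"],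
      rule frechet_derivative_transform_within_open[OF total.differentiable_g total.open_S])
     (auto intro: total.g_sym)

text \<open>Both sides equal the slice product of \<open>shape p u\<close> and
  \<open>shape p v\<close>, because the \<open>x\<close>-derivative of the slice metric is
  symmetric.\<close>

lemma shape_adjoint:
  assumes "p \<in> I \<times> U"
  shows "B p (shape p (shape p u)) v = D p (1, 0) u (shape p v)"
proof -
  have "B p (shape p (shape p u)) v = B p (shape p v) (shape p u)"
    by (simp only: shape_eq[OF assms] D_sym[OF assms, where v = v])
  also have "\<dots> = B p (shape p u) (shape p v)"
    by (rule total.g_sym[OF assms])
  also have "\<dots> = D p (1, 0) u (shape p v)"
    by (rule shape_eq[OF assms])
  finally show ?thesis .
qed

section \<open>Christoffel symbols of the total metric\<close>

lemmas deriv_h = smooth_on_real_derivs(1)[OF open_I smooth_h]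
  and deriv2_h = smooth_on_real_derivs(2)[OF open_I smooth_h]

text \<open>The candidate is checked against the equation defining \<open>sharp\<close>. Its pieces
  are the acceleration -h'/(2h) of the coordinate field of \<open>x\<close>, the normal part of the
  covariant derivative of slice vectors, the slice connection, and P/2 for the mixed terms.\<close>

lemma christoffel_total:
  assumes x: "x \<in> I" and y: "y \<in> U"
  shows "christoffel g (x, y) (a, u) (b, v) =
    (- (deriv h x / (2 * h x)) * a * b - h x / 2 * D (x, y) (1, 0) u v,
     christoffel (\<gamma> x) y u v + (1/2) *\<^sub>R (a *\<^sub>R shape (x, y) v + b *\<^sub>R shape (x, y) u))"
    (is "_ = ?Z")
proof -
  have p: "(x, y) \<in> I \<times> U"
    using x y by simp
  have dg: "frechet_derivative (\<lambda>q. g q (b, v) (t, w)) (at (x, y)) (a, u)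
      = - (b * t * deriv h x * a / (h x)\<^sup>2) + a * D (x, y) (1, 0) v w + D (x, y) (0, u) v w"
    for a u b v t w
  proof -
    have "((\<lambda>q. h (fst q)) has_derivative (\<lambda>X. deriv h x * fst X)) (at (x, y))"
      using deriv_h[OF x] unfolding has_field_derivative_def
      by (intro has_derivative_compose[where g = h and f = fst]) (auto intro!: derivative_eq_intros)
    then have "((\<lambda>q. b * t / h (fst q) + B q v w) has_derivative
        (\<lambda>X. - (b * t * deriv h x * fst X / (h x)\<^sup>2) + D (x, y) X v w)) (at (x, y))"
      using h_pos[OF x] total.differentiable_g[OF p]
      by (auto intro!: derivative_eq_intros simp: frechet_derivative_works power2_eq_square fun_eq_iff)
    then have "((\<lambda>q. g q (b, v) (t, w)) has_derivative
        (\<lambda>X. - (b * t * deriv h x * fst X / (h x)\<^sup>2) + D (x, y) X v w)) (at (x, y))"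
      by (rule has_derivative_transform_within_open[OF _ total.open_S p]) (auto simp: g_eq)
    then show ?thesis
      using D_direction[OF p, where s = a and u = u and v = v and w = w] by (simp add: frechet_derivative_at[symmetric])
  qed
  \<comment> \<open>Differentiating the slice metric along \<open>w\<close> in \<open>U\<close> is
    differentiating the total metric along \<open>(0, w)\<close>.\<close>
  have C: "christoffel (\<gamma> x) y u v
      = sharp (B (x, y)) (\<lambda>w. (D (x, y) (0, u) v w + D (x, y) (0, v) u w - D (x, y) (0, w) u v) / 2)"
  proof -
    have "frechet_derivative (\<lambda>z. \<gamma> x z u v) (at y) w = D (x, y) (0, w) u v" for u v w
    proof -
      have "((\<lambda>z. \<gamma> x z u v) has_derivative (\<lambda>w. D (x, y) (0, w) u v)) (at y)"
        by (rule has_derivative_transform_within_open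
            [OF frechet_derivative_slice(1)[OF total.differentiable_g[OF p]] smooth_metric.open_S[OF slice[OF x]] y])
           (simp add: \<gamma>_eq x)
      then show ?thesis
        by (simp add: frechet_derivative_at[symmetric])
    qed
    then show ?thesis
      by (simp add: christoffel_def sharp_\<gamma>[OF x y])
  qed
  have koszul: "linear (\<lambda>w. (D (x, y) (0, u) v w + D (x, y) (0, v) u w - D (x, y) (0, w) u v) / 2)"
    using linear_compose[OF linear_Pair_0 total.linear_koszul(1)[OF p], of "(0, v)" "(0, u)"]
    unfolding o_def .
  show ?thesis
    unfolding christoffel_def[of g]
  proof (rule sharp_eqI[OF total.inner_form_g[OF p]])
    fix W :: "real \<times> 'e"
    obtain t w where W: "W = (t, w)"
      by (cases W)
    have "B (x, y) (christoffel (\<gamma> x) y u v + (1/2) *\<^sub>R (a *\<^sub>R shape (x, y) v + b *\<^sub>R shape (x, y) u)) w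
        = (D (x, y) (0, u) v w + D (x, y) (0, v) u w - D (x, y) (0, w) u v) / 2
        + 1 / 2 * (a * D (x, y) (1, 0) v w + b * D (x, y) (1, 0) u w)"
      by (simp only: B_add[OF p] B_scale[OF p] real_scaleR_def shape_eq[OF p] C
          sharp_inner_form[OF inner_form_B[OF p] koszul])
    then have "g (x, y) ?Z W = (- (deriv h x / (2 * h x)) * a * b - h x / 2 * D (x, y) (1, 0) u v) * t / h x
        + ((D (x, y) (0, u) v w + D (x, y) (0, v) u w - D (x, y) (0, w) u v) / 2
        + 1 / 2 * (a * D (x, y) (1, 0) v w + b * D (x, y) (1, 0) u w))"
      unfolding W by (subst g_eq[OF x y], subst \<gamma>_eq[OF x y]) (simp only:)
    moreover have "(- (deriv h x / (2 * h x)) * a * b - h x / 2 * d) * t / h x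
        = (- (b * t * deriv h x * a / (h x)\<^sup>2) + - (a * t * deriv h x * b / (h x)\<^sup>2)
            - (- (a * b * deriv h x * t / (h x)\<^sup>2) + t * d)) / 2" for d
      using h_pos[OF x] by (simp add: field_simps power2_eq_square)
    ultimately show "g (x, y) ?Z W = (frechet_derivative (\<lambda>q. g q (b, v) W) (at (x, y)) (a, u)
        + frechet_derivative (\<lambda>q. g q (a, u) W) (at (x, y)) (b, v)
        - frechet_derivative (\<lambda>q. g q (a, u) (b, v)) (at (x, y)) W) / 2"
      unfolding W dg[where a = a and u = u and b = b and v = v] dg[where a = b and u = v and b = a and v = u]
        dg[where a = t and u = w and b = a and v = u and t = b and w = v]
      by (simp only: add_divide_distrib diff_divide_distrib) simp
  qed
qed

section \<open>Derivatives of the connection coefficients\<close>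

abbreviation (input) C where "C p u v \<equiv> christoffel (\<gamma> (fst p)) (snd p) u v"
abbreviation (input) D2 where "D2 p X u v \<equiv> frechet_derivative (\<lambda>q. D q (1, 0) u v) (at p) X"
abbreviation (input) DC where "DC p X u v \<equiv> frechet_derivative (\<lambda>q. C q u v) (at p) X"
abbreviation (input) DP where "DP p X u \<equiv> frechet_derivative (\<lambda>q. shape q u) (at p) X"

lemma linear_C:
  assumes "p \<in> I \<times> U"
  shows "linear (\<lambda>v. C p u v)" "linear (\<lambda>u. C p u v)"
  using assms by (auto intro!: smooth_metric.linear_christoffel[OF slice])

lemma linear_shape:
  assumes "p \<in> I \<times> U"
  shows "linear (shape p)"
  unfolding shape_def[abs_def]
  by (rule linear_sharp[OF inner_form_B[OF assms] linear_D(3,2)[OF assms]])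

lemma C_zero: "p \<in> I \<times> U \<Longrightarrow> C p u 0 = 0" "p \<in> I \<times> U \<Longrightarrow> C p 0 v = 0"
  by (fact linear_0[OF linear_C(1)] linear_0[OF linear_C(2)])+

lemma differentiable_snd_christoffel:
  assumes "p \<in> I \<times> U"
  shows "(\<lambda>q. snd (christoffel g q X Y)) differentiable (at p)"
  using total.differentiable_christoffel[OF assms, of X Y] unfolding differentiable_def
  by (elim exE) (rule exI, erule has_derivative_snd)

text \<open>The slices alone give differentiability along \<open>U\<close> only. Joint
  differentiability is obtained by recognizing \<open>C\<close> as the \<open>U\<close>-component of
  the total Christoffel symbol on vectors tangent to the slices.\<close>

lemma differentiable_C:
  assumes p: "p \<in> I \<times> U"
  shows "(\<lambda>q. C q u v) differentiable (at p)"
  using differentiable_snd_christoffel[OF p, of "(0, u)" "(0, v)"] unfolding differentiable_def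
  by (elim ex_forward has_derivative_transform_within_open[OF _ total.open_S p])
     (auto simp: christoffel_total)

text \<open>P is twice the \<open>U\<close>-component of the mixed Christoffel symbol of the total
  metric.\<close>

lemma differentiable_shape:
  assumes p: "p \<in> I \<times> U"
  shows "(\<lambda>q. shape q u) differentiable (at p)"
proof -
  have "(\<lambda>q. 2 *\<^sub>R snd (christoffel g q (1, 0) (0, u))) differentiable (at p)"
    using differentiable_snd_christoffel[OF p] by (auto intro!: derivative_intros)
  then show ?thesis
    unfolding differentiable_def
    by (elim ex_forward has_derivative_transform_within_open[OF _ total.open_S p])
       (auto simp: christoffel_total C_zero[of "(x, y)" for x y, simplified])
qed

lemma differentiable_D: "p \<in> I \<times> U \<Longrightarrow> (\<lambda>q. D q X u v) differentiable (at p)"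
  by (rule total.differentiable_Dg)

lemma deriv_zero:
  assumes p: "p \<in> I \<times> U"
  shows "DC p X u 0 = 0" "DC p X 0 v = 0" "D2 p X 0 v = 0" "D2 p X u 0 = 0" "DP p X 0 = 0"
proof -
  note l = linear_0[OF linear_frechet_derivative_family[OF total.open_S p]]
  show "DC p X u 0 = 0" "DC p X 0 v = 0"
    by (rule l; rule linear_C differentiable_C[OF p]; assumption)+
  show "D2 p X 0 v = 0" "D2 p X u 0 = 0"
    by (rule l; rule linear_D differentiable_D[OF p]; assumption)+
  show "DP p X 0 = 0"
    by (rule l; rule linear_shape differentiable_shape[OF p]; assumption)
qed

text \<open>The Christoffel coefficient of the \<open>x\<close> direction with itself. Its
  derivative is kept unevaluated because it drops out of the Ricci components below.\<close>

definition lapse_rate :: "real \<Rightarrow> real" where "lapse_rate x = - (deriv h x / (2 * h x))"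

lemma has_real_derivative_lapse_rate: "x \<in> I \<Longrightarrow> (lapse_rate has_real_derivative deriv lapse_rate x) (at x)"
  unfolding lapse_rate_def[abs_def]
  using deriv_h deriv2_h h_pos
  by (intro DERIV_deriv_iff_real_differentiable[THEN iffD2] derivative_intros)
     (auto simp: real_differentiable_def less_imp_neq[THEN not_sym])

lemma frechet_derivative_christoffel_total:
  assumes x: "x \<in> I" and y: "y \<in> U"
  shows "frechet_derivative (\<lambda>q. christoffel g q (a, u) (b, v)) (at (x, y)) X =
    (deriv lapse_rate x * fst X * a * b - deriv h x * fst X / 2 * D (x, y) (1, 0) u v - h x / 2 * D2 (x, y) X u v,
     DC (x, y) X u v + (1/2) *\<^sub>R (a *\<^sub>R DP (x, y) X v + b *\<^sub>R DP (x, y) X u))"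
proof -
  have p: "(x, y) \<in> I \<times> U"
    using x y by simp
  note d = has_derivative_fst_real[of lapse_rate _ "(x, y)", simplified, OF has_real_derivative_lapse_rate[OF x]]
    has_derivative_fst_real[of h _ "(x, y)", simplified, OF deriv_h[OF x]]
    differentiable_D[OF p, unfolded frechet_derivative_works]
    differentiable_C[OF p, unfolded frechet_derivative_works]
    differentiable_shape[OF p, unfolded frechet_derivative_works]
  have "((\<lambda>q. (lapse_rate (fst q) * a * b - h (fst q) / 2 * D q (1, 0) u v,
        C q u v + (1/2) *\<^sub>R (a *\<^sub>R shape q v + b *\<^sub>R shape q u))) has_derivative
      (\<lambda>X. (deriv lapse_rate x * fst X * a * b
          - (deriv h x * fst X / 2 * D (x, y) (1, 0) u v + h x / 2 * D2 (x, y) X u v),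
        DC (x, y) X u v + (1/2) *\<^sub>R (a *\<^sub>R DP (x, y) X v + b *\<^sub>R DP (x, y) X u)))) (at (x, y))"
    by (rule has_derivative_eq_rhs, (rule derivative_intros d | simp)+) (simp add: fun_eq_iff algebra_simps)
  then have "((\<lambda>q. christoffel g q (a, u) (b, v)) has_derivative
      (\<lambda>X. (deriv lapse_rate x * fst X * a * b
          - (deriv h x * fst X / 2 * D (x, y) (1, 0) u v + h x / 2 * D2 (x, y) X u v),
        DC (x, y) X u v + (1/2) *\<^sub>R (a *\<^sub>R DP (x, y) X v + b *\<^sub>R DP (x, y) X u)))) (at (x, y))"
    by (rule has_derivative_transform_within_open[OF _ total.open_S p])
       (auto simp: christoffel_total lapse_rate_def)
  then show ?thesis
    by (simp add: frechet_derivative_at[symmetric])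
qed

text \<open>Derivative of the identity \<open>shape_eq\<close>. The metric depends on the point as
  well, so P u is expanded in \<open>Basis\<close> and the product rule is applied to each
  summand.\<close>

lemma D2_shape:
  assumes p: "p \<in> I \<times> U"
  shows "D2 p X u v = B p (DP p X u) v + D p X (shape p u) v"
proof -
  have shape_expand: "D q (1, 0) u v = (\<Sum>b\<in>Basis. (shape q u \<bullet> b) * B q b v)" if "q \<in> I \<times> U" for q
    using linear_expand[OF inner_form_linear(2)[OF inner_form_B[OF that]], where u = "shape q u" and v1 = v]
      shape_eq[OF that, of u v] by simp
  note d = differentiable_shape[OF p, unfolded frechet_derivative_works]
    total.differentiable_g[OF p, unfolded frechet_derivative_works]
  have "((\<lambda>q. \<Sum>b\<in>Basis. (shape q u \<bullet> b) * B q b v) has_derivative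
      (\<lambda>X. \<Sum>b\<in>Basis. (shape p u \<bullet> b) * D p X b v + (DP p X u \<bullet> b) * B p b v)) (at p)"
    by (intro has_derivative_sum has_derivative_mult has_derivative_inner_left d)
  then have "((\<lambda>q. D q (1, 0) u v) has_derivative
      (\<lambda>X. \<Sum>b\<in>Basis. (shape p u \<bullet> b) * D p X b v + (DP p X u \<bullet> b) * B p b v)) (at p)"
    by (rule has_derivative_transform_within_open[OF _ total.open_S p]) (simp add: shape_expand)
  then have "D2 p X u v = (\<Sum>b\<in>Basis. (shape p u \<bullet> b) * D p X b v) + (\<Sum>b\<in>Basis. (DP p X u \<bullet> b) * B p b v)"
    by (simp add: frechet_derivative_at[symmetric] sum.distrib)
  then show ?thesis
    using linear_expand[OF inner_form_linear(2)[OF inner_form_B[OF p]], where u = "DP p X u" and v1 = v]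
      linear_expand[OF linear_D(2)[OF p], where u = "shape p u"]
    by simp
qed

section \<open>Curvature of the total metric in terms of the slices\<close>

lemma curvature_slice:
  assumes x: "x \<in> I" and y: "y \<in> U"
  shows "curvature (\<gamma> x) y u v w = DC (x, y) (0, u) v w - DC (x, y) (0, v) u w
    + C (x, y) u (C (x, y) v w) - C (x, y) v (C (x, y) u w)"
proof -
  have "(x, y) \<in> I \<times> U"
    using x y by simp
  then have "frechet_derivative (\<lambda>z. christoffel (\<gamma> x) z u v) (at y) w = DC (x, y) (0, w) u v" for u v w
    using frechet_derivative_slice(1)[OF differentiable_C, of x y u v]
    by (simp add: frechet_derivative_at[symmetric])
  then show ?thesis
    by (simp add: curvature_def)
qed

text \<open>The trace of the Riccati equation: the endomorphism sending \<open>u\<close> to R(u,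
  X)X, with X the coordinate field of \<open>x\<close>, acts on slice vectors as -P'/2 - h'/(4h) P -
  P^2/4.\<close>

lemma ricci_base:
  assumes x: "x \<in> I" and y: "y \<in> U"
  shows "ricci g (x, y) (1, 0) (1, 0) = - (1/2) * lin_trace (DP (x, y) (1, 0))
    - deriv h x / (4 * h x) * lin_trace (shape (x, y))
    - (1/4) * lin_trace (\<lambda>u. shape (x, y) (shape (x, y) u))"
proof -
  have p: "(x, y) \<in> I \<times> U"
    using x y by simp
  note zero = C_zero[OF p, simplified] deriv_zero[OF p, simplified] D_zero[OF p] linear_0[OF linear_shape[OF p]]
  have "curvature g (x, y) (0, e) (1, 0) (1, 0) \<bullet> (0, e) =
      (- (1/2) *\<^sub>R DP (x, y) (1, 0) e - (deriv h x / (4 * h x)) *\<^sub>R shape (x, y) e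
        - (1/4) *\<^sub>R shape (x, y) (shape (x, y) e)) \<bullet> e" for e
    by (simp add: curvature_def christoffel_total[OF x y] frechet_derivative_christoffel_total[OF x y] zero
        linear_scale[OF linear_shape[OF p]] inner_simps)
  moreover have "curvature g (x, y) (1, 0) (1, 0) (1, 0) = 0"
    by (simp add: curvature_def)
  ultimately show ?thesis
    by (simp add: ricci_def sum_Basis_real_prod lin_trace_def inner_simps sum.distrib sum_subtractf
        sum_distrib_left sum_negf)
qed

lemma ricci_slice:
  assumes x: "x \<in> I" and y: "y \<in> U"
  shows "ricci g (x, y) (0, v) (0, w) = ricci (\<gamma> x) y v w
    + B (x, y) (- (deriv h x / 4) *\<^sub>R shape (x, y) v - (h x / 2) *\<^sub>R DP (x, y) (1, 0) v
        - (h x / 4 * lin_trace (shape (x, y))) *\<^sub>R shape (x, y) v) w"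
proof -
  have p: "(x, y) \<in> I \<times> U"
    using x y by simp
  note zero = C_zero[OF p, simplified] deriv_zero[OF p, simplified] D_zero[OF p] linear_0[OF linear_shape[OF p]]
  let ?D = "D (x, y) (1, 0)"
  \<comment> \<open>The trace defining Ricci splits into the contribution of the \<open>x\<close>
    direction and, in the next fact, those of the slice directions, where the Gauss equation
    appears.\<close>
  have 1: "curvature g (x, y) (1, 0) (0, v) (0, w) \<bullet> (1, 0) =
      - deriv h x / 4 * ?D v w - h x / 2 * D2 (x, y) (1, 0) v w + h x / 4 * ?D v (shape (x, y) w)"
    using h_pos[OF x]
    by (simp add: curvature_def christoffel_total[OF x y] frechet_derivative_christoffel_total[OF x y] zero
        D_scale[OF p, simplified])
  have 2: "curvature g (x, y) (0, e) (0, v) (0, w) \<bullet> (0, e) = curvature (\<gamma> x) y e v w \<bullet> e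
      - h x / 4 * ?D v w * (shape (x, y) e \<bullet> e) + h x / 4 * ((shape (x, y) v \<bullet> e) * ?D e w)" for e
    unfolding curvature_slice[OF x y]
    by (simp add: curvature_def christoffel_total[OF x y] frechet_derivative_christoffel_total[OF x y] zero
        inner_simps)
  have "(\<Sum>e\<in>Basis. (shape (x, y) v \<bullet> e) * ?D e w) = ?D (shape (x, y) v) w"
    using linear_expand[OF linear_D(2)[OF p], where u = "shape (x, y) v"] by simp
  then have "ricci g (x, y) (0, v) (0, w) = ricci (\<gamma> x) y v w
      - h x / 4 * ?D v w * lin_trace (shape (x, y)) + h x / 4 * ?D (shape (x, y) v) w
      - deriv h x / 4 * ?D v w - h x / 2 * D2 (x, y) (1, 0) v w + h x / 4 * ?D v (shape (x, y) w)"
    by (simp add: ricci_def sum_Basis_real_prod 1 2 sum.distrib sum_subtractf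
        sum_distrib_left[symmetric] sum_divide_distrib[symmetric] lin_trace_def mult.assoc)
  \<comment> \<open>The terms quadratic in P cancel: \<open>D2_shape\<close> contributes one with
    factor -h/2, and the two with factor h/4 agree with each other by
    \<open>shape_adjoint\<close>.\<close>
  also have "\<dots> = ricci (\<gamma> x) y v w - h x / 4 * ?D v w * lin_trace (shape (x, y))
      - deriv h x / 4 * ?D v w - h x / 2 * B (x, y) (DP (x, y) (1, 0) v) w"
    using shape_adjoint[OF p, of v w] shape_eq[OF p, of "shape (x, y) v" w]
    by (simp add: D2_shape[OF p] algebra_simps)
  also have "\<dots> = ricci (\<gamma> x) y v w
    + B (x, y) (- (deriv h x / 4) *\<^sub>R shape (x, y) v - (h x / 2) *\<^sub>R DP (x, y) (1, 0) v
        - (h x / 4 * lin_trace (shape (x, y))) *\<^sub>R shape (x, y) v) w"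
    by (simp only: linear_diff[OF inner_form_linear(2)[OF inner_form_B[OF p]]] B_scale[OF p] shape_eq[OF p])
       simp
  finally show ?thesis .
qed

text \<open>The metric is block diagonal, so raising an index multiplies the
  \<open>x\<close>-component by h and applies the inverse of the slice metric to the rest. The mixed
  Ricci components therefore do not enter the trace.\<close>

lemma scalar_curvature_total:
  assumes x: "x \<in> I" and y: "y \<in> U"
  shows "scalar_curvature_at g (x, y) = scalar_curvature_at (\<gamma> x) y
    - deriv h x / 2 * lin_trace (shape (x, y)) - h x * lin_trace (DP (x, y) (1, 0))
    - h x / 4 * lin_trace (\<lambda>u. shape (x, y) (shape (x, y) u)) - h x / 4 * (lin_trace (shape (x, y)))\<^sup>2"
proof -
  have p: "(x, y) \<in> I \<times> U"
    using x y by simp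
  define Y where "Y v = - (deriv h x / 4) *\<^sub>R shape (x, y) v - (h x / 2) *\<^sub>R DP (x, y) (1, 0) v
      - (h x / 4 * lin_trace (shape (x, y))) *\<^sub>R shape (x, y) v" for v
  have sharp_ricci: "sharp (g (x, y)) (ricci g (x, y) (s, v)) =
      (h x * ricci g (x, y) (s, v) (1, 0), sharp (\<gamma> x y) (\<lambda>w. ricci g (x, y) (s, v) (0, w)))" for s v
  proof (rule sharp_eqI[OF total.inner_form_g[OF p]])
    fix W :: "real \<times> 'e"
    obtain t w where W: "W = (t, w)"
      by (cases W)
    have l: "linear (ricci g (x, y) (s, v))"
      by (rule total.linear_ricci[OF p])
    have "linear (\<lambda>w. ricci g (x, y) (s, v) (0, w))"
      using linear_compose[OF linear_Pair_0 l] by (simp add: o_def)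
    then have "\<gamma> x y (sharp (\<gamma> x y) (\<lambda>w. ricci g (x, y) (s, v) (0, w))) w = ricci g (x, y) (s, v) (0, w)"
      by (rule sharp_inner_form[OF smooth_metric.inner_form_g[OF slice[OF x] y]])
    moreover have "ricci g (x, y) (s, v) W = t * ricci g (x, y) (s, v) (1, 0) + ricci g (x, y) (s, v) (0, w)"
      using linear_add[OF l, of "t *\<^sub>R (1, 0)" "(0, w)"] linear_scale[OF l, of t "(1, 0)"] by (simp add: W)
    ultimately show "g (x, y) (h x * ricci g (x, y) (s, v) (1, 0),
        sharp (\<gamma> x y) (\<lambda>w. ricci g (x, y) (s, v) (0, w))) W = ricci g (x, y) (s, v) W"
      using h_pos[OF x] by (simp add: W g_eq[OF x y])
  qed
  \<comment> \<open>By \<open>ricci_slice\<close> the correction to the Ricci form of the slice is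
    represented by \<open>Y v\<close>.\<close>
  have "sharp (\<gamma> x y) (\<lambda>w. ricci g (x, y) (0, v) (0, w)) = sharp (\<gamma> x y) (ricci (\<gamma> x) y v) + Y v" for v
  proof (rule sharp_eqI)
    show f: "inner_form (\<gamma> x y)"
      by (rule smooth_metric.inner_form_g[OF slice[OF x] y])
    show "\<gamma> x y (sharp (\<gamma> x y) (ricci (\<gamma> x) y v) + Y v) w = ricci g (x, y) (0, v) (0, w)" for w
      unfolding linear_add[OF inner_form_linear(2)[OF f]]
        sharp_inner_form[OF f smooth_metric.linear_ricci[OF slice[OF x] y]]
      by (simp add: ricci_slice[OF x y] \<gamma>_eq[OF x y] Y_def)
  qed
  then have "scalar_curvature_at g (x, y) = h x * ricci g (x, y) (1, 0) (1, 0)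
      + scalar_curvature_at (\<gamma> x) y + (\<Sum>e\<in>Basis. Y e \<bullet> e)"
    by (simp add: scalar_curvature_at_def sum_Basis_real_prod sharp_ricci inner_simps sum.distrib)
  moreover have "(\<Sum>e\<in>Basis. Y e \<bullet> e) = - deriv h x / 4 * lin_trace (shape (x, y))
      - h x / 2 * lin_trace (DP (x, y) (1, 0)) - h x / 4 * (lin_trace (shape (x, y)))\<^sup>2"
    unfolding lin_trace_def Y_def
    by (simp add: inner_simps sum.distrib sum_subtractf sum_distrib_left[symmetric] sum_divide_distrib[symmetric]
        sum_negf power2_eq_square mult.assoc)
  moreover have "h x * ricci g (x, y) (1, 0) (1, 0) = - h x / 2 * lin_trace (DP (x, y) (1, 0))
      - deriv h x / 4 * lin_trace (shape (x, y)) - h x / 4 * lin_trace (\<lambda>u. shape (x, y) (shape (x, y) u))"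
    using h_pos[OF x] by (simp add: ricci_base[OF x y] field_simps)
  ultimately show ?thesis
    by simp
qed

end

section \<open>Traces and diagonal families\<close>

text \<open>Exchanging sums turns the trace into a sum over an orthonormal basis of the range, and
  \<open>f\<close> fixes each vector of that basis.\<close>

lemma lin_trace_idempotent:
  fixes f :: "'e::euclidean_space \<Rightarrow> 'e"
  assumes f: "linear f" and idem: "\<And>u. f (f u) = f u"
  shows "lin_trace f = real (dim (range f))"
proof -
  obtain B where B: "B \<subseteq> range f" "pairwise orthogonal B" "\<And>b. b \<in> B \<Longrightarrow> norm b = 1"
      "independent B" "card B = dim (range f)" "span B = range f"
    using orthonormal_basis_subspace[OF linear_subspace_image[OF f subspace_UNIV]] by metis
  have fin: "finite B"
    using B(4) by (rule independent_imp_finite)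
  have expand: "f u = (\<Sum>b\<in>B. (f u \<bullet> b) *\<^sub>R b)" for u
    using orthonormal_basis_expand[OF B(2,3) _ fin, of "f u"] B(6) by simp
  have "lin_trace f = (\<Sum>e\<in>Basis. \<Sum>b\<in>B. (f e \<bullet> b) * (b \<bullet> e))"
    unfolding lin_trace_def by (subst expand) (simp add: inner_sum_left)
  also have "\<dots> = (\<Sum>b\<in>B. (\<Sum>e\<in>Basis. (b \<bullet> e) *\<^sub>R f e) \<bullet> b)"
    by (subst sum.swap) (simp add: inner_sum_left mult.commute)
  also have "\<dots> = (\<Sum>b\<in>B. f b \<bullet> b)"
    by (simp add: linear_expand[OF f, symmetric])
  also have "\<dots> = (\<Sum>b\<in>B. 1)"
  proof (rule sum.cong)
    fix b assume b: "b \<in> B"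
    then have "f b = b"
      using B(1) idem by auto
    then show "f b \<bullet> b = 1"
      using B(3)[OF b] by (simp add: norm_eq_1)
  qed simp
  finally show ?thesis
    by (simp add: B(5))
qed

text \<open>\<open>Z i\<close> gives the \<open>P i\<close>-component of the vector represented by an element of \<open>\<Oplus> P i\<close> under \<open>T\<close>.\<close>

lemma component_maps:
  fixes T :: "'f::euclidean_space \<Rightarrow> 'e::euclidean_space" and P :: "nat \<Rightarrow> 'f set"
  assumes T: "linear T" and P: "\<And>i. i \<le> m \<Longrightarrow> subspace (P i)"
    and inj: "\<And>X. (\<And>i. i \<le> m \<Longrightarrow> X i \<in> P i) \<Longrightarrow> T (\<Sum>i\<le>m. X i) = 0 \<Longrightarrow> (\<And>i. i \<le> m \<Longrightarrow> X i = 0)"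
    and surj: "\<And>u. \<exists>X. (\<forall>i\<le>m. X i \<in> P i) \<and> u = T (\<Sum>i\<le>m. X i)"
  obtains Z where "\<And>i. i \<le> m \<Longrightarrow> linear (Z i)" "\<And>i u. i \<le> m \<Longrightarrow> Z i u \<in> P i"
    "\<And>u. T (\<Sum>i\<le>m. Z i u) = u"
    "\<And>i j u. i \<le> m \<Longrightarrow> j \<le> m \<Longrightarrow> Z i (T (Z j u)) = (if i = j then Z j u else 0)"
    "\<And>i. i \<le> m \<Longrightarrow> lin_trace (\<lambda>u. T (Z i u)) = real (dim (P i))"
proof -
  obtain X where X: "\<And>u i. i \<le> m \<Longrightarrow> X u i \<in> P i" "\<And>u. u = T (\<Sum>i\<le>m. X u i)"
    using surj by metis
  have unique: "X u i = Y i" if "\<And>i. i \<le> m \<Longrightarrow> Y i \<in> P i" "T (\<Sum>i\<le>m. Y i) = u" "i \<le> m" for u Y i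
  proof -
    have "X u i - Y i = 0"
    proof (rule inj[of "\<lambda>i. X u i - Y i"])
      show "X u i - Y i \<in> P i" if "i \<le> m" for i
        using X(1) P \<open>\<And>i. i \<le> m \<Longrightarrow> Y i \<in> P i\<close> that by (simp add: subspace_diff)
      show "T (\<Sum>i\<le>m. X u i - Y i) = 0"
        using X(2)[of u] that(2) by (simp add: sum_subtractf linear_diff[OF T])
    qed fact
    then show ?thesis
      by simp
  qed
  define Z where "Z i u = X u i" for i u
  have lin: "linear (Z i)" if i: "i \<le> m" for i
  proof (rule linearI)
    show "Z i (u + v) = Z i u + Z i v" for u v
      unfolding Z_def
      using X(2)[of u] X(2)[of v] P X(1)
      by (intro unique[OF _ _ i]) (simp_all add: subspace_add sum.distrib linear_add[OF T])
    show "Z i (r *\<^sub>R u) = r *\<^sub>R Z i u" for r u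
      unfolding Z_def
      using X(2)[of u] P X(1)
      by (intro unique[OF _ _ i]) (simp_all add: subspace_scale scaleR_sum_right[symmetric] linear_scale[OF T])
  qed
  \<comment> \<open>Uniqueness of components, applied to the family whose only possibly nonzero
    member is \<open>Y\<close> in position \<open>j\<close>.\<close>
  have proj: "Z i (T Y) = (if i = j then Y else 0)" if "i \<le> m" "j \<le> m" "Y \<in> P j" for i j Y
    unfolding Z_def using that P
    by (intro unique[of "\<lambda>i. if i = j then Y else 0"]) (simp_all add: subspace_0)
  have "lin_trace (\<lambda>u. T (Z i u)) = real (dim (P i))" if i: "i \<le> m" for i
  proof -
    have ZP: "Z i u \<in> P i" for u
      unfolding Z_def by (rule X(1)[OF i])
    have "lin_trace (\<lambda>u. T (Z i u)) = real (dim (range (\<lambda>u. T (Z i u))))"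
      using linear_compose[OF lin[OF i] T] proj[OF i i ZP]
      by (intro lin_trace_idempotent) (simp_all add: o_def)
    also have "range (\<lambda>u. T (Z i u)) = T ` P i"
      using ZP proj[OF i i] by (auto simp: image_iff) metis
    also have "inj_on T (P i)"
      using proj[OF i i] by (intro inj_on_inverseI[of _ "Z i"]) simp
    then have "dim (T ` P i) = dim (P i)"
      by (intro dim_image_eq[OF T]) (simp add: span_eq_iff[THEN iffD2, OF P[OF i]])
    finally show ?thesis
      by simp
  qed
  then show ?thesis
    using lin X(1) X(2)[symmetric] proj[OF _ _ X(1)]
    by (intro that[of Z]) (auto simp: Z_def)
qed

lemma lin_trace_sum:
  "lin_trace (\<lambda>u. \<Sum>i\<in>J. c i *\<^sub>R f i u) = (\<Sum>i\<in>J. c i * lin_trace (f i))"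
  unfolding lin_trace_def by (simp add: inner_sum_left sum_distrib_left) (rule sum.swap)

section \<open>Scalar curvature of a diagonal family\<close>

context metric_family
begin

text \<open>The maps \<open>T\<close> after \<open>Z i\<close> are complementary projections
  independent of \<open>x\<close>, and P is diagonal for them with eigenvalues w'/w. A formula for
  the metrics over the single point \<open>y\<close> suffices, since
  \<open>scalar_curvature_total\<close> differentiates P only in the \<open>x\<close>
  direction.\<close>

lemma scalar_curvature_diagonal:
  fixes T :: "'f::euclidean_space \<Rightarrow> 'e" and Z :: "nat \<Rightarrow> 'e \<Rightarrow> 'f" and m :: nat
  assumes x: "x \<in> I" and y: "y \<in> U"
    and T: "linear T" and Z: "\<And>i. i \<le> m \<Longrightarrow> linear (Z i)" and Q: "bilinear Q"
    and proj: "\<And>i j u. i \<le> m \<Longrightarrow> j \<le> m \<Longrightarrow> Z i (T (Z j u)) = (if i = j then Z j u else 0)"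
    and w_pos: "\<And>i \<xi>. i \<le> m \<Longrightarrow> \<xi> \<in> I \<Longrightarrow> w i \<xi> > 0"
    and dw: "\<And>i \<xi>. i \<le> m \<Longrightarrow> \<xi> \<in> I \<Longrightarrow> (w i has_real_derivative w' i \<xi>) (at \<xi>)"
    and ddw: "\<And>i \<xi>. i \<le> m \<Longrightarrow> \<xi> \<in> I \<Longrightarrow> (w' i has_real_derivative w'' i \<xi>) (at \<xi>)"
    and \<gamma>: "\<And>\<xi> u v. \<xi> \<in> I \<Longrightarrow> \<gamma> \<xi> y u v = (\<Sum>i\<le>m. w i \<xi> * Q (Z i u) (Z i v))"
    and d: "\<And>i. i \<le> m \<Longrightarrow> lin_trace (\<lambda>u. T (Z i u)) = d i"
  shows "scalar_curvature_at g (x, y) = scalar_curvature_at (\<gamma> x) y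
    - deriv h x / 2 * (\<Sum>i\<le>m. d i * (w' i x / w i x))
    - h x * (\<Sum>i\<le>m. d i * (w'' i x / w i x - (w' i x / w i x)\<^sup>2))
    - h x / 4 * (\<Sum>i\<le>m. d i * (w' i x / w i x)\<^sup>2)
    - h x / 4 * (\<Sum>i\<le>m. d i * (w' i x / w i x))\<^sup>2"
proof -
  have Z_sum: "Z i (\<Sum>j\<le>m. a j *\<^sub>R T (Z j u)) = a i *\<^sub>R Z i u" if i: "i \<le> m" for i a u
  proof -
    have "Z i (\<Sum>j\<le>m. a j *\<^sub>R T (Z j u)) = (\<Sum>j\<le>m. a j *\<^sub>R (if i = j then Z j u else 0))"
      using proj[OF i] by (simp add: linear_sum[OF Z[OF i]] linear_scale[OF Z[OF i]])
    also have "\<dots> = a i *\<^sub>R Z i u"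
      using i by (subst if_distrib[of "scaleR _"]) (simp add: if_distrib[of "scaleR _"] cong: if_cong)
    finally show ?thesis .
  qed
  \<comment> \<open>Established for every parameter \<open>\<xi>\<close> in \<open>I\<close>, not
    just \<open>x\<close>, so that it can be differentiated in the next step.\<close>
  have shape: "shape (\<xi>, y) u = (\<Sum>i\<le>m. (w' i \<xi> / w i \<xi>) *\<^sub>R T (Z i u))" if \<xi>: "\<xi> \<in> I" for \<xi> u
    unfolding shape_def
  proof (rule sharp_eqI)
    have p: "(\<xi>, y) \<in> I \<times> U"
      using \<xi> y by simp
    show "inner_form (B (\<xi>, y))"
      by (rule inner_form_B[OF p])
    fix v
    have "((\<lambda>t. B (t, y) u v) has_derivative (\<lambda>s. D (\<xi>, y) (s, 0) u v)) (at \<xi>)"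
      by (rule frechet_derivative_slice(2)[OF total.differentiable_g[OF p]])
    moreover have "((\<lambda>t. B (t, y) u v) has_derivative
        (\<lambda>s. (\<Sum>i\<le>m. w' i \<xi> * Q (Z i u) (Z i v)) * s)) (at \<xi>)"
    proof -
      have "((\<lambda>t. \<Sum>i\<le>m. w i t * Q (Z i u) (Z i v)) has_real_derivative
          (\<Sum>i\<le>m. w' i \<xi> * Q (Z i u) (Z i v))) (at \<xi>)"
        using dw[OF _ \<xi>] by (intro DERIV_sum DERIV_cmult_right) auto
      then have "((\<lambda>t. \<Sum>i\<le>m. w i t * Q (Z i u) (Z i v)) has_derivative
          (\<lambda>s. (\<Sum>i\<le>m. w' i \<xi> * Q (Z i u) (Z i v)) * s)) (at \<xi>)"
        by (simp add: has_field_derivative_def)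
      then show ?thesis
        by (rule has_derivative_transform_within_open[OF _ open_I \<xi>])
           (simp add: \<gamma> \<gamma>_eq[OF _ y, symmetric])
    qed
    ultimately have "D (\<xi>, y) (1, 0) u v = (\<Sum>i\<le>m. w' i \<xi> * Q (Z i u) (Z i v))"
      by (drule_tac has_derivative_unique) (auto dest!: fun_cong[of _ _ 1])
    moreover have "B (\<xi>, y) (\<Sum>i\<le>m. (w' i \<xi> / w i \<xi>) *\<^sub>R T (Z i u)) v
        = (\<Sum>i\<le>m. w' i \<xi> * Q (Z i u) (Z i v))"
      unfolding \<gamma>_eq[OF \<xi> y, symmetric] \<gamma>[OF \<xi>]
    proof (rule sum.cong)
      fix i assume "i \<in> {..m}"
      then have i: "i \<le> m"
        by simp
      have "Q ((w' i \<xi> / w i \<xi>) *\<^sub>R Z i u) (Z i v) = w' i \<xi> / w i \<xi> * Q (Z i u) (Z i v)"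
        using Q by (simp add: bilinear_lmul)
      then show "w i \<xi> * Q (Z i (\<Sum>i\<le>m. (w' i \<xi> / w i \<xi>) *\<^sub>R T (Z i u))) (Z i v)
          = w' i \<xi> * Q (Z i u) (Z i v)"
        using w_pos[OF i \<xi>] by (simp add: Z_sum[OF i])
    qed simp
    ultimately show "B (\<xi>, y) (\<Sum>i\<le>m. (w' i \<xi> / w i \<xi>) *\<^sub>R T (Z i u)) v = D (\<xi>, y) (1, 0) u v"
      by simp
  qed
  have p: "(x, y) \<in> I \<times> U"
    using x y by simp
  \<comment> \<open>Only the eigenvalues depend on the parameter, so differentiating P means
    differentiating w'/w.\<close>
  have dshape: "frechet_derivative (\<lambda>q. shape q u) (at (x, y)) (1, 0)
      = (\<Sum>i\<le>m. (w'' i x / w i x - (w' i x / w i x)\<^sup>2) *\<^sub>R T (Z i u))" for u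
  proof -
    have "((\<lambda>t. shape (t, y) u) has_derivative
        (\<lambda>s. frechet_derivative (\<lambda>q. shape q u) (at (x, y)) (s, 0))) (at x)"
      by (rule frechet_derivative_slice(2)[OF differentiable_shape[OF p]])
    moreover have "((\<lambda>t. shape (t, y) u) has_derivative
        (\<lambda>s. s *\<^sub>R (\<Sum>i\<le>m. (w'' i x / w i x - (w' i x / w i x)\<^sup>2) *\<^sub>R T (Z i u)))) (at x)"
    proof -
      have "((\<lambda>t. w' i t / w i t) has_real_derivative w'' i x / w i x - (w' i x / w i x)\<^sup>2) (at x)"
        if i: "i \<le> m" for i
        using DERIV_divide[OF ddw[OF i x] dw[OF i x]] w_pos[OF i x]
        by (simp add: diff_divide_distrib power2_eq_square)
      then have "((\<lambda>t. \<Sum>i\<le>m. (w' i t / w i t) *\<^sub>R T (Z i u)) has_vector_derivative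
          (\<Sum>i\<le>m. (w'' i x / w i x - (w' i x / w i x)\<^sup>2) *\<^sub>R T (Z i u))) (at x)"
        by (intro has_vector_derivative_sum has_vector_derivative_scaleR[where g' = 0, simplified]) auto
      then show ?thesis
        unfolding has_vector_derivative_def
        by (rule has_derivative_transform_within_open[OF _ open_I x]) (simp add: shape)
    qed
    ultimately show ?thesis
      by (drule_tac has_derivative_unique) (auto dest!: fun_cong[of _ _ 1])
  qed
  have shape2: "shape (x, y) (shape (x, y) u) = (\<Sum>i\<le>m. (w' i x / w i x)\<^sup>2 *\<^sub>R T (Z i u))" for u
    unfolding shape[OF x] by (simp add: Z_sum linear_scale[OF T] power2_eq_square)
  have tr: "lin_trace (\<lambda>u. \<Sum>i\<le>m. c i *\<^sub>R T (Z i u)) = (\<Sum>i\<le>m. d i * c i)" for c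
    by (simp add: lin_trace_sum d mult.commute)
  show ?thesis
    unfolding scalar_curvature_total[OF x y] shape2 dshape
    by (simp only: tr shape[OF x, THEN ext])
qed

end

section \<open>The tangent space of a homogeneous space\<close>

lemma is_chartD:
  assumes "is_chart c"
  shows "open (fst c)" "open (snd c ` fst c)" "inj_on (snd c) (fst c)"
  using assms unfolding is_chart_def homeomorphism_def inj_on_def by metis+

text \<open>The action is smooth in product charts; freezing the coordinate of the second factor at
  that of \<open>z\<close> leaves the orbit map.\<close>

lemma differentiable_coord_map_orbit:
  assumes act: "smooth_action G \<G> \<N> act" and c: "c \<in> \<G>" "is_chart c" "a \<in> fst c"
    and d: "d \<in> \<N>" "is_chart d" "z \<in> fst d" "act a z \<in> fst d"
  shows "coord_map c d (\<lambda>a. act a z) differentiable (at (snd c a))"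
proof -
  define C where "C = (fst c \<times> fst d, map_prod (snd c) (snd d))"
  define F where "F = coord_map C d (\<lambda>(a, q). act a q)"
  have "C \<in> prod_atlas \<G> \<N>"
    unfolding prod_atlas_def C_def using c(1) d(1) by blast
  then have "smooth_on (snd C ` (fst C \<inter> (\<lambda>(a, q). act a q) -` fst d)) F"
    using act d(1) by (auto simp: smooth_action_def smooth_map_def smooth_in_charts_def F_def)
  moreover have "(snd c a, snd d z) \<in> snd C ` (fst C \<inter> (\<lambda>(a, q). act a q) -` fst d)"
    using c(3) d(3,4) by (intro image_eqI[of _ _ "(a, z)"]) (auto simp: C_def)
  ultimately have "F differentiable (at (snd c a, snd d z))"
    by (rule smooth_on_differentiable)
  then have "(\<lambda>u. F (u, snd d z)) differentiable (at (snd c a))"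
    using frechet_derivative_slice(2) unfolding differentiable_def by blast
  moreover have "F (u, snd d z) = coord_map c d (\<lambda>a. act a z) u" if "u \<in> snd c ` fst c" for u
  proof -
    obtain a' where a': "u = snd c a'" "a' \<in> fst c"
      using \<open>u \<in> snd c ` fst c\<close> by auto
    have inj: "inj_on (snd C) (fst C)"
      using is_chartD(3)[OF c(2)] is_chartD(3)[OF d(2)] by (auto simp: C_def inj_on_def)
    have "inv_into (fst C) (snd C) (snd C (a', z)) = (a', z)"
      by (rule inv_into_f_f[OF inj]) (use a' d(3) in \<open>simp add: C_def\<close>)
    then have "inv_into (fst C) (snd C) (u, snd d z) = (a', z)"
      by (simp add: C_def a')
    moreover have "inv_into (fst c) (snd c) u = a'"
      using is_chartD(3)[OF c(2)] a' by simp
    ultimately show ?thesis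
      by (simp add: F_def coord_map_def)
  qed
  ultimately show ?thesis
    unfolding differentiable_def
    by (elim ex_forward has_derivative_transform_within_open[OF _ is_chartD(2)[OF c(2)]])
       (use c(3) in auto)
qed

text \<open>The orbit map is constant along a curve in the stabilizer, so the chain rule gives zero
  on its velocity.\<close>

lemma tangent_map_orbit_stabilizer:
  assumes act: "smooth_action G \<G> \<N> act" and c: "c \<in> \<G>" "is_chart c" "\<one>\<^bsub>G\<^esub> \<in> fst c"
    and d: "d \<in> \<N>" "is_chart d" "z \<in> fst d"
    and one: "act \<one>\<^bsub>G\<^esub> z = z" and X: "X \<in> lie_subalgebra G \<G> c (stabilizer G act z)"
  shows "tangent_map c d (\<lambda>a. act a z) \<one>\<^bsub>G\<^esub> X = 0"
proof -
  obtain \<gamma> where \<gamma>: "smooth_map {(UNIV, id :: real \<Rightarrow> real)} \<G> \<gamma>" "range \<gamma> \<subseteq> stabilizer G act z"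
      "\<gamma> 0 = \<one>\<^bsub>G\<^esub>" "((snd c \<circ> \<gamma>) has_vector_derivative X) (at 0)"
    using X by (auto simp: lie_subalgebra_def)
  let ?F = "coord_map c d (\<lambda>a. act a z)"
  have "(?F has_derivative tangent_map c d (\<lambda>a. act a z) \<one>\<^bsub>G\<^esub>) (at ((snd c \<circ> \<gamma>) 0))"
    using differentiable_coord_map_orbit[OF act c d] one d(3) \<gamma>(3)
    by (simp add: tangent_map_def frechet_derivative_works)
  then have "((\<lambda>t. ?F ((snd c \<circ> \<gamma>) t)) has_derivative
      (\<lambda>s. tangent_map c d (\<lambda>a. act a z) \<one>\<^bsub>G\<^esub> (s *\<^sub>R X))) (at 0)"
    using \<gamma>(4) unfolding has_vector_derivative_def by (rule has_derivative_compose[rotated])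
  moreover have "((\<lambda>t. ?F ((snd c \<circ> \<gamma>) t)) has_derivative (\<lambda>s. 0)) (at 0)"
  proof (rule has_derivative_transform_within_open)
    show "((\<lambda>t. snd d z) has_derivative (\<lambda>s. 0)) (at 0)"
      by simp
    \<comment> \<open>Only while the curve stays in the chart domain does the inverse chart recover
      its points.\<close>
    show "open (\<gamma> -` fst c)"
      using \<gamma>(1) is_chartD(1)[OF c(2)] by (auto simp: smooth_map_def intro: open_vimage)
    show "0 \<in> \<gamma> -` fst c"
      using \<gamma>(3) c(3) by simp
    show "snd d z = ?F ((snd c \<circ> \<gamma>) t)" if "t \<in> \<gamma> -` fst c" for t
      using that is_chartD(3)[OF c(2)] \<gamma>(2) by (auto simp: coord_map_def stabilizer_def image_subset_iff)
  qed
  ultimately have "(\<lambda>s. tangent_map c d (\<lambda>a. act a z) \<one>\<^bsub>G\<^esub> (s *\<^sub>R X)) = (\<lambda>s. 0)"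
    by (rule has_derivative_unique)
  then show ?thesis
    by (auto dest: fun_cong[of _ _ 1])
qed

lemma smooth_structureD:
  assumes "smooth_structure \<A>"
  shows "c \<in> \<A> \<Longrightarrow> is_chart c" "\<exists>c\<in>\<A>. q \<in> fst c"
  using assms unfolding smooth_structure_def by blast+

lemma riemannian_metric_smooth_metric:
  assumes "smooth_structure \<A>" "riemannian_metric \<A> g" "c \<in> \<A>"
  shows "smooth_metric (snd c ` fst c) (g c)"
  using assms(2,3) is_chartD(2)[OF smooth_structureD(1)[OF assms(1,3)]]
  by (auto simp: smooth_metric_def riemannian_metric_def inner_form_def)

text \<open>The tangent map of \<open>a \<mapsto> act a z\<close> at the identity kills \<open>\<kk>\<close>, so it restricts to an
  isomorphism from \<open>\<pp> 0 \<oplus> \<dots> \<oplus> \<pp> m\<close> onto the tangent space of \<open>G/K\<close>.\<close>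

lemma homogeneous_tangent_components:
  fixes \<N> :: "('n::{t2_space,second_countable_topology}, 'e::euclidean_space) chart set"
    and \<pp> :: "nat \<Rightarrow> 'f::euclidean_space set"
  assumes G: "lie_group G \<G>" and hom: "homogeneous_space G \<G> K \<N> act z"
    and c: "c \<in> \<G>" "\<one>\<^bsub>G\<^esub> \<in> fst c" and d: "d \<in> \<N>" "z \<in> fst d"
    and decomp: "isotropy_decomposition G \<G> c K m \<pp>"
    and Q: "invariant_inner_product (Ad G c) K m \<pp> Q"
    and metric: "homogeneous_metric G c \<N> act z m \<pp> Q w \<gamma>" and w: "\<And>i. i \<le> m \<Longrightarrow> w i > 0"
  obtains T Z where "linear T" "\<And>i. i \<le> m \<Longrightarrow> linear (Z i)"
    "\<And>i j u. i \<le> m \<Longrightarrow> j \<le> m \<Longrightarrow> Z i (T (Z j u)) = (if i = j then Z j u else 0)"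
    "\<And>i. i \<le> m \<Longrightarrow> lin_trace (\<lambda>u. T (Z i u)) = real (dim (\<pp> i))"
    "\<And>w \<gamma> u v. homogeneous_metric G c \<N> act z m \<pp> Q w \<gamma> \<Longrightarrow>
      \<gamma> d (snd d z) u v = (\<Sum>i\<le>m. w i * Q (Z i u) (Z i v))"
proof -
  have N: "smooth_structure \<N>" and act: "smooth_action G \<G> \<N> act" and K: "K = stabilizer G act z"
    and surj: "surj (tangent_map c d (\<lambda>a. act a z) \<one>\<^bsub>G\<^esub>)"
    using hom c d by (auto simp: homogeneous_space_def)
  have chart_c: "is_chart c" and chart_d: "is_chart d"
    using G smooth_structureD(1)[OF _ c(1)] smooth_structureD(1)[OF N d(1)] by (simp_all add: lie_group_def)
  have one: "act \<one>\<^bsub>G\<^esub> z = z"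
    using act fun_cong[OF group_action.id_eq_one[of G UNIV act], of z] by (simp add: smooth_action_def)
  define T where "T = tangent_map c d (\<lambda>a. act a z) \<one>\<^bsub>G\<^esub>"
  have T: "linear T"
    unfolding T_def tangent_map_def
    using differentiable_coord_map_orbit[OF act c(1) chart_c c(2) d(1) chart_d d(2)] one d(2)
    by (simp add: linear_frechet_derivative)
  have P: "subspace (\<pp> i)" if "i \<le> m" for i
    using decomp that
    by (auto simp: isotropy_decomposition_def irreducible_subspace_def invariant_subspace_def)
  \<comment> \<open>Weights and metric are quantified afresh here, so that a single choice of
    \<open>T\<close> and \<open>Z\<close> serves every homogeneous metric.\<close>
  have metric_T: "\<gamma> d (snd d z) (T (\<Sum>i\<le>m. X i)) (T (\<Sum>i\<le>m. Y i)) = (\<Sum>i\<le>m. w i * Q (X i) (Y i))"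
    if "homogeneous_metric G c \<N> act z m \<pp> Q w \<gamma>" "\<And>i. i \<le> m \<Longrightarrow> X i \<in> \<pp> i" "\<And>i. i \<le> m \<Longrightarrow> Y i \<in> \<pp> i"
    for w \<gamma> X Y
    using that d unfolding homogeneous_metric_def T_def by blast
  have Q_pos: "Q X X > 0" if "i \<le> m" "X \<in> \<pp> i" "X \<noteq> 0" for i X
  proof -
    have "X \<in> span (\<Union>i\<le>m. \<pp> i)"
      using that by (intro span_base) auto
    then show ?thesis
      using Q that(3) by (simp add: invariant_inner_product_def Let_def)
  qed
  have Q_nonneg: "Q X X \<ge> 0" if "i \<le> m" "X \<in> \<pp> i" for i X
    using Q_pos[OF that] Q by (cases "X = 0") (auto simp: invariant_inner_product_def Let_def bilinear_lzero)
  \<comment> \<open>By \<open>metric_T\<close> the squared length of the image is a sum of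
    nonnegative terms, positive as soon as one component is nonzero.\<close>
  have inj: "X i = 0" if X: "\<And>i. i \<le> m \<Longrightarrow> X i \<in> \<pp> i" "T (\<Sum>i\<le>m. X i) = 0" "i \<le> m" for X i
  proof (rule ccontr)
    assume "X i \<noteq> 0"
    then have "(\<Sum>i\<le>m. w i * Q (X i) (X i)) > 0"
      using X(1,3) Q_nonneg Q_pos w
      by (intro sum_pos2[of _ i]) (auto simp: less_imp_le)
    moreover have "bilinear (\<gamma> d (snd d z))"
      using metric d by (auto simp: homogeneous_metric_def riemannian_metric_def)
    ultimately show False
      using metric_T[OF metric X(1) X(1)] X(2) by (simp add: bilinear_lzero)
  qed
  have surj': "\<exists>X. (\<forall>i\<le>m. X i \<in> \<pp> i) \<and> u = T (\<Sum>i\<le>m. X i)" for u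
  proof -
    obtain Y where "u = T Y"
      using surj unfolding T_def by (metis surjE)
    moreover obtain W X where "W \<in> lie_subalgebra G \<G> c K" "\<forall>i\<le>m. X i \<in> \<pp> i" "Y = W + (\<Sum>i\<le>m. X i)"
      using decomp unfolding isotropy_decomposition_def direct_sum_decomposition_def by metis
    moreover from this(1) have "T W = 0"
      unfolding T_def K by (rule tangent_map_orbit_stabilizer[OF act c(1) chart_c c(2) d(1) chart_d d(2) one])
    ultimately show ?thesis
      by (auto simp: linear_add[OF T])
  qed
  show ?thesis
  proof (rule component_maps[of T m \<pp>])
    show "linear T" "\<And>i. i \<le> m \<Longrightarrow> subspace (\<pp> i)"
      by (fact T P)+
    show "X i = 0" if "\<And>i. i \<le> m \<Longrightarrow> X i \<in> \<pp> i" "T (\<Sum>i\<le>m. X i) = 0" "i \<le> m" for X i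
      using that by (rule inj)
    show "\<exists>X. (\<forall>i\<le>m. X i \<in> \<pp> i) \<and> u = T (\<Sum>i\<le>m. X i)" for u
      by (rule surj')
    fix Z
    assume Z: "\<And>i. i \<le> m \<Longrightarrow> linear (Z i)" "\<And>i u. i \<le> m \<Longrightarrow> Z i u \<in> \<pp> i"
      "\<And>u. T (\<Sum>i\<le>m. Z i u) = u"
      "\<And>i j u. i \<le> m \<Longrightarrow> j \<le> m \<Longrightarrow> Z i (T (Z j u)) = (if i = j then Z j u else 0)"
      "\<And>i. i \<le> m \<Longrightarrow> lin_trace (\<lambda>u. T (Z i u)) = real (dim (\<pp> i))"
    have "\<gamma> d (snd d z) u v = (\<Sum>i\<le>m. w i * Q (Z i u) (Z i v))"
      if "homogeneous_metric G c \<N> act z m \<pp> Q w \<gamma>" for w \<gamma> u v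
      using metric_T[OF that, of "\<lambda>i. Z i u" "\<lambda>i. Z i v"] by (simp add: Z(2,3))
    with T Z(1,4,5) show ?thesis
      by (rule that)
  qed
qed

section \<open>Metrics of cohomogeneity one\<close>

text \<open>The left side says that (h r)'' = q r on \<open>I\<close>. Since r' = \<phi> r, the
  second derivative of h r is the right-hand expression times r, and the positive factor r cancels.
  Using the logarithmic derivative \<phi> avoids a formula for r''.\<close>

lemma iterated_antiderivative_iff:
  fixes h r h' h'' \<phi> \<phi>' q :: "real \<Rightarrow> real"
  assumes I: "open I"
    and h: "\<And>x. x \<in> I \<Longrightarrow> (h has_real_derivative h' x) (at x)"
      "\<And>x. x \<in> I \<Longrightarrow> (h' has_real_derivative h'' x) (at x)"
    and r: "\<And>x. x \<in> I \<Longrightarrow> r x > 0" "\<And>x. x \<in> I \<Longrightarrow> (r has_real_derivative \<phi> x * r x) (at x)"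
    and \<phi>: "\<And>x. x \<in> I \<Longrightarrow> (\<phi> has_real_derivative \<phi>' x) (at x)"
  shows "(\<exists>F1 F2. (\<forall>x\<in>I. (F1 has_real_derivative q x * r x) (at x)) \<and>
      (\<forall>x\<in>I. (F2 has_real_derivative F1 x) (at x)) \<and> (\<forall>x\<in>I. h x = 1 / r x * F2 x))
    \<longleftrightarrow> (\<forall>x\<in>I. q x = h'' x + 2 * \<phi> x * h' x + (\<phi>' x + (\<phi> x)\<^sup>2) * h x)"
    (is "?L \<longleftrightarrow> ?R")
proof -
  \<comment> \<open>The derivative of h r; it is the first antiderivative in the converse direction,
    with h r as the second.\<close>
  define G where "G x = (h' x + \<phi> x * h x) * r x" for x
  have dhr: "((\<lambda>x. h x * r x) has_real_derivative G x) (at x)" if "x \<in> I" for x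
    unfolding G_def using h(1)[OF that] r(2)[OF that]
    by (auto intro!: derivative_eq_intros simp: algebra_simps)
  have dG: "(G has_real_derivative (h'' x + 2 * \<phi> x * h' x + (\<phi>' x + (\<phi> x)\<^sup>2) * h x) * r x) (at x)"
    if "x \<in> I" for x
    unfolding G_def[abs_def] using h[OF that] r(2)[OF that] \<phi>[OF that]
    by (auto intro!: derivative_eq_intros simp: algebra_simps power2_eq_square)
  show ?thesis
  proof
    assume ?L
    then obtain F1 F2 where F: "\<And>x. x \<in> I \<Longrightarrow> (F1 has_real_derivative q x * r x) (at x)"
        "\<And>x. x \<in> I \<Longrightarrow> (F2 has_real_derivative F1 x) (at x)" "\<And>x. x \<in> I \<Longrightarrow> h x = 1 / r x * F2 x"
      by blast
    have F1_eq: "F1 x = G x" if "x \<in> I" for x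
    proof (rule DERIV_unique)
      show "((\<lambda>x. h x * r x) has_real_derivative F1 x) (at x)"
        using F(2)[OF that] I that
        by (rule has_field_derivative_transform_within_open) (use F(3) r(1) in \<open>force\<close>)
    qed (rule dhr[OF that])
    have "(F1 has_real_derivative (h'' x + 2 * \<phi> x * h' x + (\<phi>' x + (\<phi> x)\<^sup>2) * h x) * r x) (at x)"
      if "x \<in> I" for x
      by (rule has_field_derivative_transform_within_open[OF dG[OF that] I that]) (simp add: F1_eq)
    then show ?R
      using F(1) r(1) by (metis DERIV_unique less_irrefl mult_right_cancel)
  next
    assume R: ?R
    show ?L
    proof (intro exI conjI ballI)
      show "(G has_real_derivative q x * r x) (at x)" if "x \<in> I" for x
        using dG[OF that] R that by simp
      show "((\<lambda>x. h x * r x) has_real_derivative G x) (at x)" if "x \<in> I" for x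
        by (rule dhr[OF that])
      show "h x = 1 / r x * (h x * r x)" if "x \<in> I" for x
        using r(1)[OF that] by simp
    qed
  qed
qed

text \<open>Logarithmic differentiation: on \<open>I\<close> the product is the exponential of a sum
  of logarithms.\<close>

lemma has_real_derivative_prod_powr:
  fixes A :: "'i \<Rightarrow> real \<Rightarrow> real"
  assumes "open I" "x \<in> I" "finite J"
    and pos: "\<And>j \<xi>. j \<in> J \<Longrightarrow> \<xi> \<in> I \<Longrightarrow> A j \<xi> > 0"
    and A: "\<And>j. j \<in> J \<Longrightarrow> (A j has_real_derivative A' j) (at x)"
  shows "((\<lambda>x. \<Prod>j\<in>J. A j x powr e j) has_real_derivative
    (\<Sum>j\<in>J. e j * (A' j / A j x)) * (\<Prod>j\<in>J. A j x powr e j)) (at x)"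
proof -
  have exp_ln: "exp (\<Sum>j\<in>J. e j * ln (A j \<xi>)) = (\<Prod>j\<in>J. A j \<xi> powr e j)" if "\<xi> \<in> I" for \<xi>
    unfolding exp_sum[OF assms(3)]
  proof (rule prod.cong)
    show "exp (e j * ln (A j \<xi>)) = A j \<xi> powr e j" if "j \<in> J" for j
      using pos[OF that \<open>\<xi> \<in> I\<close>] by (simp add: powr_def)
  qed simp
  have "((\<lambda>x. ln (A j x)) has_real_derivative A' j / A j x) (at x)" if "j \<in> J" for j
    using A[OF that] pos[OF that assms(2)] by (auto intro!: derivative_eq_intros simp: field_simps)
  then have "((\<lambda>x. exp (\<Sum>j\<in>J. e j * ln (A j x))) has_real_derivative
      exp (\<Sum>j\<in>J. e j * ln (A j x)) * (\<Sum>j\<in>J. e j * (A' j / A j x))) (at x)"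
    by (intro DERIV_chain2[OF DERIV_exp] DERIV_sum DERIV_cmult)
  then have "((\<lambda>x. \<Prod>j\<in>J. A j x powr e j) has_real_derivative
      exp (\<Sum>j\<in>J. e j * ln (A j x)) * (\<Sum>j\<in>J. e j * (A' j / A j x))) (at x)"
    using assms(1,2) by (rule has_field_derivative_transform_within_open) (rule exp_ln)
  then show ?thesis
    using exp_ln[OF assms(2)] by (simp add: mult.commute)
qed

lemma tube_chart_simps:
  assumes "equivariant_tube G \<N> actN \<M> actM I \<Phi>"
  shows "x \<in> I \<Longrightarrow> snd (tube_chart \<Phi> I d) (\<Phi> (x, q)) = (x, snd d q)"
    "x \<in> I \<Longrightarrow> q \<in> fst d \<Longrightarrow> \<Phi> (x, q) \<in> fst (tube_chart \<Phi> I d)"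
    "snd (tube_chart \<Phi> I d) ` fst (tube_chart \<Phi> I d) = I \<times> snd d ` fst d"
proof -
  have inj: "inj_on \<Phi> (I \<times> UNIV)"
    using assms by (simp add: equivariant_tube_def)
  show *: "snd (tube_chart \<Phi> I d) (\<Phi> (x, q)) = (x, snd d q)" if "x \<in> I" for x q
    using that inv_into_f_f[OF inj, of "(x, q)"] by (simp add: tube_chart_def)
  show "\<Phi> (x, q) \<in> fst (tube_chart \<Phi> I d)" if "x \<in> I" "q \<in> fst d"
    using that by (simp add: tube_chart_def)
  have "snd (tube_chart \<Phi> I d) ` fst (tube_chart \<Phi> I d)
      = (\<lambda>(x, q). snd (tube_chart \<Phi> I d) (\<Phi> (x, q))) ` (I \<times> fst d)"
    by (auto simp: tube_chart_def image_iff)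
  also have "\<dots> = (\<lambda>(x, q). (x, snd d q)) ` (I \<times> fst d)"
    by (rule image_cong) (auto simp: *)
  also have "\<dots> = I \<times> snd d ` fst d"
    by auto
  finally show "snd (tube_chart \<Phi> I d) ` fst (tube_chart \<Phi> I d) = I \<times> snd d ` fst d" .
qed

text \<open>The terms in \<open>h'\<^sup>2/h\<close> contributed by the summand \<open>\<pp> 0\<close>, on which the metric coefficient is
  \<open>h\<close> itself, cancel against those from the lapse \<open>h\<^sup>-\<^sup>1\<^sup>/\<^sup>2\<close>.\<close>

lemma diagonal_terms_eq:
  fixes h :: real
  assumes "h > 0"
  shows "- h' / 2 * (h' / h + 2 * \<phi>) - h * ((h'' / h - (h' / h)\<^sup>2) + 2 * \<psi>)
      - h / 4 * ((h' / h)\<^sup>2 + \<sigma>) - h / 4 * (h' / h + 2 * \<phi>)\<^sup>2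
    = - (h'' + 2 * \<phi> * h' + (\<psi> + \<phi>\<^sup>2) * h) - h * (\<psi> + \<sigma> / 4)"
  using assms by (simp add: field_simps power2_eq_square)

text \<open>The freedom in the antiderivatives \<open>F1\<close> and \<open>F2\<close> on the
  interval \<open>I\<close> is the choice of the two constants of integration.\<close>

theorem theorem11p4:
  fixes G :: "'g::{t2_space,second_countable_topology} monoid"
    and \<G> :: "('g, 'f::euclidean_space) chart set"
    and K :: "'g set"
    and \<N> :: "('n::{t2_space,second_countable_topology}, 'e::euclidean_space) chart set"
    and actN :: "'g \<Rightarrow> 'n \<Rightarrow> 'n" and z :: 'n
    and \<M> :: "('m::{t2_space,second_countable_topology}, real \<times> 'e) chart set"
    and g :: "('m, real \<times> 'e) tensor2"
    and actM :: "'g \<Rightarrow> 'm \<Rightarrow> 'm"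
    and c :: "('g, 'f) chart"
    and m :: nat and \<pp> :: "nat \<Rightarrow> 'f set" and Q :: "'f \<Rightarrow> 'f \<Rightarrow> real"
    and I :: "real set" and \<Phi> :: "real \<times> 'n \<Rightarrow> 'm"
    and h :: "real \<Rightarrow> real" and A :: "nat \<Rightarrow> real \<Rightarrow> real"
    and S :: "'m \<Rightarrow> real" and b :: "nat \<Rightarrow> real" and Sstar :: "(nat \<Rightarrow> real) \<Rightarrow> real"
  defines "rootV \<equiv> (\<lambda>x. \<Prod>j=1..m. A j x powr (real (dim (\<pp> j)) / 2))"
  assumes "lie_group G \<G>" and "compact (UNIV :: 'g set)" and "simply_connected (UNIV :: 'g set)"
    and "homogeneous_space G \<G> K \<N> actN z" and "connected K"
    and "smooth_structure \<M>" and "connected (UNIV :: 'm set)" and "riemannian_metric \<M> g"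
    and "smooth_action G \<G> \<M> actM" and "\<forall>a\<in>carrier G. isometric \<M> g (actM a)"
    and "principal_isotropy G actM K"
    and "open I" and "is_interval I" and "I \<noteq> {}"
    and "equivariant_tube G \<N> actN \<M> actM I \<Phi>"
    and "c \<in> \<G>" and "\<one>\<^bsub>G\<^esub> \<in> fst c"
    and "isotropy_decomposition G \<G> c K m \<pp>"
    and "\<forall>i\<le>m. \<forall>j\<le>m. i \<noteq> j \<longrightarrow> \<not> equivalent_subspaces (Ad G c) K (\<pp> i) (\<pp> j)"
    and "dim (\<pp> 0) = 1"
    and "invariant_inner_product (Ad G c) K m \<pp> Q"
    and "smooth_on I h" and "\<forall>x\<in>I. h x > 0"
    and "\<forall>j\<in>{1..m}. smooth_on I (A j) \<and> (\<forall>x\<in>I. A j x > 0)"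
    and "cohomogeneity_one_metric G c \<N> actN z m \<pp> Q I \<Phi> h A g"
    and "is_scalar_curvature \<M> g S"
    and "orbit_curvature_decomposition G c \<N> actN z m \<pp> Q b Sstar"
  shows "(\<exists>F1 F2.
            (\<forall>x\<in>I. (F1 has_real_derivative
                (Sstar (\<lambda>j. A j x) - S (\<Phi> (x, z))) * rootV x) (at x)) \<and>
            (\<forall>x\<in>I. (F2 has_real_derivative F1 x) (at x)) \<and>
            (\<forall>x\<in>I. h x = 1 / rootV x * F2 x))
     \<longleftrightarrow> (\<forall>x\<in>I. (\<Sum>j=1..m. real (dim (\<pp> j)) *
              (2 * (deriv (deriv (A j)) x / A j x) - (deriv (A j) x / A j x)\<^sup>2
               + (b j)\<^sup>2 / (A j x)\<^sup>2)) = 0)"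
proof -
  note homogeneous = assms(5) and tube = assms(16) and Q = assms(22) and smooth_h = assms(23)
    and h_pos = assms(24) and A = assms(25) and metric = assms(26) and curvature_S = assms(27)
    and curvature_orbit = assms(28) and I = assms(13)
  have N: "smooth_structure \<N>"
    using homogeneous by (simp add: homogeneous_space_def)
  obtain d where d: "d \<in> \<N>" "z \<in> fst d"
    using smooth_structureD(2)[OF N] by blast
  \<comment> \<open>A chart of \<open>\<M>\<close> with image \<open>I \<times> U\<close> in which
    the metric has the block form of \<open>metric_family\<close>.\<close>
  define C where "C = tube_chart \<Phi> I d"
  define U where "U = snd d ` fst d"
  have C: "C \<in> \<M>" "snd C ` fst C = I \<times> U"
    using tube d(1) tube_chart_simps(3)[OF tube] by (simp_all add: equivariant_tube_def C_def U_def)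
  have y: "snd d z \<in> U"
    using d(2) by (simp add: U_def)
  obtain \<gamma> where \<gamma>: "\<And>x. x \<in> I \<Longrightarrow>
        homogeneous_metric G c \<N> actN z m \<pp> Q ((\<lambda>j. A j x)(0 := h x)) (\<gamma> x)"
      "\<And>x y s t u v. x \<in> I \<Longrightarrow> y \<in> U \<Longrightarrow> g C (x, y) (s, u) (t, v) = 1 / h x * s * t + \<gamma> x d y u v"
    using metric d(1) unfolding cohomogeneity_one_metric_def C_def U_def by metis
  interpret chart: metric_family I U "g C" "\<lambda>x. \<gamma> x d" h
  proof (intro metric_family.intro metric_family_axioms.intro)
    show "smooth_metric (I \<times> U) (g C)"
      using riemannian_metric_smooth_metric[OF assms(7,9) C(1)] by (simp add: C(2))
    show "smooth_metric U (\<gamma> x d)" if "x \<in> I" for x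
      using \<gamma>(1)[OF that] riemannian_metric_smooth_metric[OF N _ d(1)]
      by (simp add: homogeneous_metric_def U_def)
  qed (use I smooth_h h_pos \<gamma>(2) in auto)
  \<comment> \<open>All metric coefficients under one index, with \<open>h\<close> in position
    0.\<close>
  define w where "w = A(0 := h)"
  have w_eq: "(\<lambda>j. A j x)(0 := h x) = (\<lambda>i. w i x)" for x
    by (auto simp: w_def)
  have w: "smooth_on I (w i)" "\<And>x. x \<in> I \<Longrightarrow> w i x > 0" if "i \<le> m" for i
    using that A smooth_h h_pos by (auto simp: w_def)
  obtain x0 where x0: "x0 \<in> I"
    using assms(15) by blast
  \<comment> \<open>The splitting is built from the orbit at an arbitrary \<open>x0\<close>; its
    last property holds for the metrics of all orbits.\<close>
  obtain T :: "'f \<Rightarrow> 'e" and Z where T: "linear T" and Z: "\<And>i. i \<le> m \<Longrightarrow> linear (Z i)"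
      "\<And>i j u. i \<le> m \<Longrightarrow> j \<le> m \<Longrightarrow> Z i (T (Z j u)) = (if i = j then Z j u else 0)"
      "\<And>i. i \<le> m \<Longrightarrow> lin_trace (\<lambda>u. T (Z i u)) = real (dim (\<pp> i))"
      "\<And>w \<gamma> u v. homogeneous_metric G c \<N> actN z m \<pp> Q w \<gamma> \<Longrightarrow>
        \<gamma> d (snd d z) u v = (\<Sum>i\<le>m. w i * Q (Z i u) (Z i v))"
    by (rule homogeneous_tangent_components[OF assms(2) homogeneous assms(17,18) d assms(19) Q
          \<gamma>(1)[OF x0, unfolded w_eq] w(2)[OF _ x0]]) (blast intro: that)+
  \<comment> \<open>\<phi> is the logarithmic derivative of \<open>rootV\<close> and \<psi> its
    derivative. With the sums below, the expression in the claim is 4\<psi> + \<sigma> +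
    \<beta>.\<close>
  define \<phi> where "\<phi> x = (\<Sum>j=1..m. real (dim (\<pp> j)) / 2 * (deriv (A j) x / A j x))" for x
  define \<psi> where "\<psi> x = (\<Sum>j=1..m. real (dim (\<pp> j)) / 2 *
      (deriv (deriv (A j)) x / A j x - (deriv (A j) x / A j x)\<^sup>2))" for x
  define \<sigma> where "\<sigma> x = (\<Sum>j=1..m. real (dim (\<pp> j)) * (deriv (A j) x / A j x)\<^sup>2)" for x
  define \<beta> where "\<beta> x = (\<Sum>j=1..m. real (dim (\<pp> j)) * ((b j)\<^sup>2 / (A j x)\<^sup>2))" for x
  have orbit: "scalar_curvature_at (\<gamma> x d) (snd d z) = - h x * (\<beta> x / 4) + Sstar (\<lambda>j. A j x)"
    if x: "x \<in> I" for x
  proof -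
    have "is_scalar_curvature \<N> (\<gamma> x) (\<lambda>_. - h x * (\<Sum>j=1..m. real (dim (\<pp> j)) / 4 * ((b j)\<^sup>2 / (A j x)\<^sup>2))
        + Sstar (\<lambda>j. A j x))"
      using curvature_orbit[unfolded orbit_curvature_decomposition_def, rule_format, of "h x" "\<lambda>j. A j x" "\<gamma> x"]
        x h_pos A \<gamma>(1)[OF x] by simp
    moreover have "(\<Sum>j=1..m. real (dim (\<pp> j)) / 4 * ((b j)\<^sup>2 / (A j x)\<^sup>2)) = \<beta> x / 4"
      unfolding \<beta>_def sum_divide_distrib by (rule sum.cong) simp_all
    ultimately show ?thesis
      using d by (simp only: is_scalar_curvature_def)
  qed
  have split: "(\<Sum>i\<le>m. f i) = f 0 + (\<Sum>i=1..m. f i)" for f :: "nat \<Rightarrow> real"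
    by (simp add: atMost_atLeast0 sum.atLeast_Suc_atMost)
  \<comment> \<open>By the formula in \<open>iterated_antiderivative_iff\<close>, the part without
    the last summand is the second derivative of h times \<open>rootV\<close>, divided by
    \<open>rootV\<close>. The obstruction is the last summand.\<close>
  have S: "Sstar (\<lambda>j. A j x) - S (\<Phi> (x, z)) = deriv (deriv h) x + 2 * \<phi> x * deriv h x
      + (\<psi> x + (\<phi> x)\<^sup>2) * h x + h x * (\<psi> x + \<sigma> x / 4 + \<beta> x / 4)" if x: "x \<in> I" for x
  proof -
    have "S (\<Phi> (x, z)) = scalar_curvature_at (g C) (x, snd d z)"
      using curvature_S C(1) tube_chart_simps(1)[OF tube x, of d z] tube_chart_simps(2)[OF tube x d(2)]
      by (simp add: is_scalar_curvature_def C_def)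
    also have "\<dots> = scalar_curvature_at (\<gamma> x d) (snd d z)
        - deriv h x / 2 * (\<Sum>i\<le>m. real (dim (\<pp> i)) * (deriv (w i) x / w i x))
        - h x * (\<Sum>i\<le>m. real (dim (\<pp> i)) * (deriv (deriv (w i)) x / w i x - (deriv (w i) x / w i x)\<^sup>2))
        - h x / 4 * (\<Sum>i\<le>m. real (dim (\<pp> i)) * (deriv (w i) x / w i x)\<^sup>2)
        - h x / 4 * (\<Sum>i\<le>m. real (dim (\<pp> i)) * (deriv (w i) x / w i x))\<^sup>2"
    proof (rule chart.scalar_curvature_diagonal[OF x y T Z(1) _ Z(2) w(2) _ _ _ Z(3)])
      show "bilinear Q"
        using Q by (simp add: invariant_inner_product_def Let_def)
      show "\<gamma> \<xi> d (snd d z) u v = (\<Sum>i\<le>m. w i \<xi> * Q (Z i u) (Z i v))" if "\<xi> \<in> I" for \<xi> u v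
        using Z(4)[OF \<gamma>(1)[OF that]] by (simp add: w_eq)
    qed (use smooth_on_real_derivs[OF I w(1)] in auto)
    \<comment> \<open>In this sum and the next two, the term with index 0 is split off; it has
      coefficient \<open>h\<close> and, since \<open>dim (\<pp> 0) = 1\<close>, multiplicity
      one.\<close>
    also have "(\<Sum>i\<le>m. real (dim (\<pp> i)) * (deriv (w i) x / w i x)) = deriv h x / h x + 2 * \<phi> x"
      unfolding split by (simp add: w_def assms(21) \<phi>_def sum_distrib_left)
    also have "(\<Sum>i\<le>m. real (dim (\<pp> i)) * (deriv (deriv (w i)) x / w i x - (deriv (w i) x / w i x)\<^sup>2))
        = (deriv (deriv h) x / h x - (deriv h x / h x)\<^sup>2) + 2 * \<psi> x"
      unfolding split by (simp add: w_def assms(21) \<psi>_def sum_distrib_left)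
    also have "(\<Sum>i\<le>m. real (dim (\<pp> i)) * (deriv (w i) x / w i x)\<^sup>2) = (deriv h x / h x)\<^sup>2 + \<sigma> x"
      unfolding split by (simp add: w_def assms(21) \<sigma>_def)
    finally show ?thesis
      using diagonal_terms_eq[of "h x" "deriv h x" "\<phi> x" "deriv (deriv h) x" "\<psi> x" "\<sigma> x"] h_pos x
      by (simp add: orbit[OF x] algebra_simps)
  qed
  have dA: "(A j has_real_derivative deriv (A j) x) (at x)"
      "(deriv (A j) has_real_derivative deriv (deriv (A j)) x) (at x)" "A j x > 0"
    if "j \<in> {1..m}" "x \<in> I" for j x
    using smooth_on_real_derivs[OF I _ that(2)] A that by blast+
  have "(\<phi> has_real_derivative \<psi> x) (at x)" if x: "x \<in> I" for x
    unfolding \<phi>_def[abs_def] \<psi>_def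
  proof (intro DERIV_sum DERIV_cmult)
    show "((\<lambda>x. deriv (A j) x / A j x) has_real_derivative
        deriv (deriv (A j)) x / A j x - (deriv (A j) x / A j x)\<^sup>2) (at x)" if "j \<in> {1..m}" for j
      using DERIV_divide[OF dA(2,1)[OF that x]] dA(3)[OF that x]
      by (simp add: diff_divide_distrib power2_eq_square)
  qed
  moreover have "rootV x > 0" if "x \<in> I" for x
    unfolding rootV_def using dA(3)[OF _ that] by (intro prod_pos) (simp add: powr_gt_zero less_imp_neq[THEN not_sym])
  moreover have "(rootV has_real_derivative \<phi> x * rootV x) (at x)" if "x \<in> I" for x
    unfolding rootV_def \<phi>_def using dA(1,3) that
    by (intro has_real_derivative_prod_powr[OF I]) auto
  ultimately have "(\<exists>F1 F2.
        (\<forall>x\<in>I. (F1 has_real_derivative (Sstar (\<lambda>j. A j x) - S (\<Phi> (x, z))) * rootV x) (at x)) \<and>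
        (\<forall>x\<in>I. (F2 has_real_derivative F1 x) (at x)) \<and> (\<forall>x\<in>I. h x = 1 / rootV x * F2 x))
      \<longleftrightarrow> (\<forall>x\<in>I. Sstar (\<lambda>j. A j x) - S (\<Phi> (x, z)) = deriv (deriv h) x + 2 * \<phi> x * deriv h x
        + (\<psi> x + (\<phi> x)\<^sup>2) * h x)"
    by (intro iterated_antiderivative_iff[OF I smooth_on_real_derivs[OF I smooth_h]])
  \<comment> \<open>By \<open>S\<close> the two sides differ by h times the bracket, and h is
    positive.\<close>
  also have "\<dots> \<longleftrightarrow> (\<forall>x\<in>I. \<psi> x + \<sigma> x / 4 + \<beta> x / 4 = 0)"
  proof (rule ball_cong)
    fix x assume x: "x \<in> I"
    then have "h x \<noteq> 0"
      using h_pos by force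
    then show "(Sstar (\<lambda>j. A j x) - S (\<Phi> (x, z)) = deriv (deriv h) x + 2 * \<phi> x * deriv h x
        + (\<psi> x + (\<phi> x)\<^sup>2) * h x) \<longleftrightarrow> \<psi> x + \<sigma> x / 4 + \<beta> x / 4 = 0"
      by (simp add: S[OF x])
  qed simp
  also have "\<dots> \<longleftrightarrow> (\<forall>x\<in>I. (\<Sum>j=1..m. real (dim (\<pp> j)) *
      (2 * (deriv (deriv (A j)) x / A j x) - (deriv (A j) x / A j x)\<^sup>2 + (b j)\<^sup>2 / (A j x)\<^sup>2)) = 0)"
  proof -
    have "(\<Sum>j=1..m. real (dim (\<pp> j)) *
        (2 * (deriv (deriv (A j)) x / A j x) - (deriv (A j) x / A j x)\<^sup>2 + (b j)\<^sup>2 / (A j x)\<^sup>2))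
        = 4 * \<psi> x + \<sigma> x + \<beta> x" for x
      unfolding \<psi>_def \<sigma>_def \<beta>_def sum_distrib_left sum.distrib[symmetric]
      by (intro sum.cong) (simp_all add: algebra_simps)
    moreover have "\<psi> x + \<sigma> x / 4 + \<beta> x / 4 = (4 * \<psi> x + \<sigma> x + \<beta> x) / 4" for x
      by simp
    ultimately show ?thesis
      by (simp only: divide_eq_0_iff) simp
  qed
  finally show ?thesis .
qed

end
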